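(* Let $X$ be a compact metric space, $\varepsilon>0$, and $c\in C(X\times X;[0,\infty))$ symmetric such that $k_c=\exp(-c/\varepsilon)$ is a positive definite universal kernel. The metric tensor $\tilde{\mathbf{g}}_\mu(\dot\beta,\dot\beta)$, defined for pairs $(\mu,\dot\beta)\in\mathcal{P}(X)\times\mathcal{H}_c$ with $\langle B(\mu),\dot\beta\rangle_{\mathcal{H}_c}=0$, is jointly continuous with respect to weak-$*$ convergence of $\mu$ in $\mathcal{P}(X)$ and norm convergence of $\dot\beta$ in $\mathcal{H}_c$, and jointly lower semicontinuous with respect to weak-$*$ convergence of $\mu$ in $\mathcal{P}(X)$ and weak convergence of $\dot\beta$ in $\mathcal{H}_c$ (convergence of sequences).
   Context: $\mathcal{P}(X)$: Radon probability measures. A kernel is universal if its reproducing kernel Hilbert space (RKHS) is dense in $C(X)$. For $\mu\in\mathcal{P}(X)$, $f_{\mu,\mu}\in C(X)$ is the unique function with $\int_X\exp\left(\frac1\varepsilon(f_{\mu,\mu}(x)+f_{\mu,\mu}(y)-c(x,y))\right)d\mu(x)=1$ for all $y\in X$; $a_\mu=\exp(f_{\mu,\mu}/\varepsilon)$; $k_\mu(x,y)=a_\mu(x)a_\mu(y)k_c(x,y)$; $K_\mu[\phi](y)=\int_X\phi(x)k_\mu(x,y)\,d\mu(x)$. $\mathcal{H}_c$ is the RKHS of $k_c$ and $B(\mu)=\int_X a_\mu(x)k_c(x,\cdot)\,d\mu(x)=\exp(-f_{\mu,\mu}/\varepsilon)\in\mathcal{H}_c$. For $\dot\beta\in\mathcal{H}_c$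 with $\langle B(\mu),\dot\beta\rangle_{\mathcal{H}_c}=0$ (equivalently $\int a_\mu\dot\beta\,d\mu=0$), $$\tilde{\mathbf{g}}_\mu(\dot\beta,\dot\beta)=\frac\varepsilon2\left(\|\dot\beta\|_{\mathcal{H}_c}^2+2\left\langle a_\mu\dot\beta,(\mathrm{id}-K_\mu)^{-1}[a_\mu\dot\beta]\right\rangle_{L^2(X,\mu)}\right),$$ where $(\mathrm{id}-K_\mu)^{-1}$ is taken on $L^2(X,\mu)/\mathbb{R}$ (quotient by constants), on which $\mathrm{id}-K_\mu$ is boundedly invertible; the pairing is well defined since $a_\mu\dot\beta$ has zero $\mu$-mean. *)

theory Defs
  imports "HOL-Probability.Probability"
begin

text \<open>
  The space \<open>X\<close> is the whole type \<open>'a\<close>; its compactness is a hypothesis of the theorem.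
  A Hilbert space is a type of class \<open>{real_inner, banach}\<close>.
\<close>

definition positive_definite_kernel :: "('a \<Rightarrow> 'a \<Rightarrow> real) \<Rightarrow> bool" where
  "positive_definite_kernel k \<longleftrightarrow>
     (\<forall>x y. k x y = k y x) \<and>
     (\<forall>S \<alpha>. finite S \<longrightarrow> (\<Sum>x\<in>S. \<Sum>y\<in>S. \<alpha> x * \<alpha> y * k x y) \<ge> 0)"

text \<open>
  The elements of an RKHS are functions. Here the Hilbert space \<open>'h\<close> is identified with a space of
  functions through the injective evaluation map: \<open>fun_of h\<close> is the function given by \<open>h\<close>. By the
  Moore-Aronszajn theorem such a space exists for every positive definite \<open>k\<close> and is unique up to
  isometry commuting with \<open>fun_of\<close>, so that it may be referred to as the RKHS of \<open>k\<close>.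
\<close>

definition is_rkhs :: "('a \<Rightarrow> 'a \<Rightarrow> real) \<Rightarrow> ('h::{real_inner, banach} \<Rightarrow> 'a \<Rightarrow> real) \<Rightarrow> bool" where
  "is_rkhs k fun_of \<longleftrightarrow>
     (\<forall>x. linear (\<lambda>h. fun_of h x)) \<and> inj fun_of \<and>
     (\<forall>x. \<exists>kx. fun_of kx = k x \<and> (\<forall>h. h \<bullet> kx = fun_of h x))"

text \<open>
  On a compact space the type of bounded continuous functions, with its supremum norm, is \<open>C(X)\<close>.
  The RKHS of a continuous kernel consists of continuous functions, so intersecting with \<open>C(X)\<close>
  loses nothing.
\<close>

definition universal_rkhs :: "('h::{real_inner, banach} \<Rightarrow> 'a::metric_space \<Rightarrow> real) \<Rightarrow> bool" where
  "universal_rkhs fun_of \<longleftrightarrow>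
     closure {f :: 'a \<Rightarrow>\<^sub>C real. apply_bcontfun f \<in> range fun_of} = UNIV"

definition weakly_converges :: "(nat \<Rightarrow> 'h::real_normed_vector) \<Rightarrow> 'h \<Rightarrow> bool" where
  "weakly_converges \<beta>s \<beta> \<longleftrightarrow>
     (\<forall>L :: 'h \<Rightarrow> real. bounded_linear L \<longrightarrow> (\<lambda>n. L (\<beta>s n)) \<longlonglongrightarrow> L \<beta>)"

text \<open>Every Borel probability measure on a compact metric space is Radon.\<close>

definition prob_measures :: "'a::metric_space measure set" where
  "prob_measures = {\<mu>. prob_space \<mu> \<and> sets \<mu> = sets borel}"

definition weak_star_converges :: "(nat \<Rightarrow> 'a::metric_space measure) \<Rightarrow> 'a measure \<Rightarrow> bool" where
  "weak_star_converges \<mu>s \<mu> \<longleftrightarrow>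
     (\<forall>\<phi> :: 'a \<Rightarrow> real. continuous_on UNIV \<phi> \<longrightarrow>
        (\<lambda>n. \<integral>x. \<phi> x \<partial>\<mu>s n) \<longlonglongrightarrow> (\<integral>x. \<phi> x \<partial>\<mu>))"

definition kernel_c :: "real \<Rightarrow> ('a \<Rightarrow> 'a \<Rightarrow> real) \<Rightarrow> 'a \<Rightarrow> 'a \<Rightarrow> real" where
  "kernel_c \<epsilon> c x y = exp (- c x y / \<epsilon>)"

definition self_potential ::
  "real \<Rightarrow> ('a::metric_space \<Rightarrow> 'a \<Rightarrow> real) \<Rightarrow> 'a measure \<Rightarrow> 'a \<Rightarrow> real" where
  "self_potential \<epsilon> c \<mu> =
     (THE f. continuous_on UNIV f \<and>
        (\<forall>y. (\<integral>x. exp (1 / \<epsilon> * (f x + f y - c x y)) \<partial>\<mu>) = 1))"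

definition a_fun ::
  "real \<Rightarrow> ('a::metric_space \<Rightarrow> 'a \<Rightarrow> real) \<Rightarrow> 'a measure \<Rightarrow> 'a \<Rightarrow> real" where
  "a_fun \<epsilon> c \<mu> x = exp (self_potential \<epsilon> c \<mu> x / \<epsilon>)"

definition kernel_mu ::
  "real \<Rightarrow> ('a::metric_space \<Rightarrow> 'a \<Rightarrow> real) \<Rightarrow> 'a measure \<Rightarrow> 'a \<Rightarrow> 'a \<Rightarrow> real" where
  "kernel_mu \<epsilon> c \<mu> x y = a_fun \<epsilon> c \<mu> x * a_fun \<epsilon> c \<mu> y * kernel_c \<epsilon> c x y"

definition K_op ::
  "real \<Rightarrow> ('a::metric_space \<Rightarrow> 'a \<Rightarrow> real) \<Rightarrow> 'a measure \<Rightarrow> ('a \<Rightarrow> real) \<Rightarrow> 'a \<Rightarrow> real" where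
  "K_op \<epsilon> c \<mu> \<phi> y = (\<integral>x. \<phi> x * kernel_mu \<epsilon> c \<mu> x y \<partial>\<mu>)"

text \<open>Pettis form of \<open>\<integral> a\<^sub>\<mu>(x) k\<^sub>c(x,\<cdot>) d\<mu>(x)\<close>: the integral is evaluated pointwise.\<close>

definition B_map ::
  "real \<Rightarrow> ('a::metric_space \<Rightarrow> 'a \<Rightarrow> real) \<Rightarrow> ('h::{real_inner, banach} \<Rightarrow> 'a \<Rightarrow> real)
     \<Rightarrow> 'a measure \<Rightarrow> 'h" where
  "B_map \<epsilon> c fun_of \<mu> =
     (THE h. fun_of h = (\<lambda>y. \<integral>x. a_fun \<epsilon> c \<mu> x * kernel_c \<epsilon> c x y \<partial>\<mu>))"

definition L2_functions :: "'a measure \<Rightarrow> ('a \<Rightarrow> real) set" where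
  "L2_functions \<mu> = {\<phi> \<in> borel_measurable \<mu>. integrable \<mu> (\<lambda>x. (\<phi> x)\<^sup>2)}"

definition eq_mod_const :: "'a measure \<Rightarrow> (('a \<Rightarrow> real) \<times> ('a \<Rightarrow> real)) set" where
  "eq_mod_const \<mu> = {(\<phi>, \<psi>). \<phi> \<in> L2_functions \<mu> \<and> \<psi> \<in> L2_functions \<mu> \<and>
     (\<exists>r. AE x in \<mu>. \<phi> x - \<psi> x = r)}"

definition L2_mod_const :: "'a measure \<Rightarrow> ('a \<Rightarrow> real) set set" where
  "L2_mod_const \<mu> = L2_functions \<mu> // eq_mod_const \<mu>"

text \<open>Since \<open>K\<^sub>\<mu>\<close> fixes constants, all classes in the union below coincide.\<close>

definition id_minus_K ::
  "real \<Rightarrow> ('a::metric_space \<Rightarrow> 'a \<Rightarrow> real) \<Rightarrow> 'a measure \<Rightarrow> ('a \<Rightarrow> real) set \<Rightarrow> ('a \<Rightarrow> real) set" where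
  "id_minus_K \<epsilon> c \<mu> Q = (\<Union>\<phi>\<in>Q. eq_mod_const \<mu> `` {\<lambda>y. \<phi> y - K_op \<epsilon> c \<mu> \<phi> y})"

definition id_minus_K_inv ::
  "real \<Rightarrow> ('a::metric_space \<Rightarrow> 'a \<Rightarrow> real) \<Rightarrow> 'a measure \<Rightarrow> ('a \<Rightarrow> real) set \<Rightarrow> ('a \<Rightarrow> real) set" where
  "id_minus_K_inv \<epsilon> c \<mu> = the_inv_into (L2_mod_const \<mu>) (id_minus_K \<epsilon> c \<mu>)"

text \<open>The \<open>L\<^sup>2\<close> inner product of a function of zero \<open>\<mu>\<close>-mean with a class modulo constants,
  i.e. the common value of its inner products with the representatives of the class.\<close>

definition L2_pairing :: "'a measure \<Rightarrow> ('a \<Rightarrow> real) \<Rightarrow> ('a \<Rightarrow> real) set \<Rightarrow> real" where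
  "L2_pairing \<mu> \<phi> Q = (THE v. \<forall>\<psi>\<in>Q. (\<integral>x. \<phi> x * \<psi> x \<partial>\<mu>) = v)"

definition tangent_pairs ::
  "real \<Rightarrow> ('a::metric_space \<Rightarrow> 'a \<Rightarrow> real) \<Rightarrow> ('h::{real_inner, banach} \<Rightarrow> 'a \<Rightarrow> real)
     \<Rightarrow> ('a measure \<times> 'h) set" where
  "tangent_pairs \<epsilon> c fun_of = {(\<mu>, \<beta>). \<mu> \<in> prob_measures \<and> B_map \<epsilon> c fun_of \<mu> \<bullet> \<beta> = 0}"

definition metric_tensor ::
  "real \<Rightarrow> ('a::metric_space \<Rightarrow> 'a \<Rightarrow> real) \<Rightarrow> ('h::{real_inner, banach} \<Rightarrow> 'a \<Rightarrow> real)
     \<Rightarrow> 'a measure \<Rightarrow> 'h \<Rightarrow> real" where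
  "metric_tensor \<epsilon> c fun_of \<mu> \<beta> =
     (let a\<beta> = (\<lambda>x. a_fun \<epsilon> c \<mu> x * fun_of \<beta> x)
      in \<epsilon> / 2 * ((norm \<beta>)\<^sup>2 +
           2 * L2_pairing \<mu> a\<beta> (id_minus_K_inv \<epsilon> c \<mu> (eq_mod_const \<mu> `` {a\<beta>}))))"

end

theory Submission imports Defs begin

text \<open>
  The scaling \<open>a\<^sub>\<mu>\<close> is a fixed point of a map that contracts the oscillation of its logarithm by
  \<open>1 - m\<^sup>2\<close>, where \<open>m\<close> is a positive lower bound of the kernel; this gives existence and uniqueness of
  \<open>a\<^sub>\<mu>\<close> as well as its uniform dependence on \<open>\<mu>\<close>. The operator \<open>K\<^sub>\<mu>\<close> contracts oscillations by the same
  factor, so on a continuous function of zero mean the inverse of \<open>id - K\<^sub>\<mu>\<close> is represented by a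
  continuous function that also depends uniformly on the data. Bounded sets of the RKHS are
  equicontinuous, hence weak convergence of \<open>\<beta>\<close> becomes uniform convergence and the second term of the
  metric tensor is even continuous for it, while the squared norm is lower semicontinuous. The second
  term is nonnegative, which bounds the norms along any subsequence of bounded metric tensor.
\<close>

section \<open>Hilbert spaces and oscillation contractions\<close>

text \<open>The spaces \<open>L\<^sup>2(\<mu>s n)\<close> change with \<open>n\<close>, so the
  inverses of id - K on them cannot be compared directly. The estimates therefore live in C(X) with
  the oscillation sup f - inf f, a seminorm that does not mention the measure and vanishes exactly
  on the constants, which among continuous functions are the kernel of id - K. The contraction
  factor depends on the bounds of the kernel alone and hence is the same along the whole sequence.
  Convergence is always obtained by inserting the limit object into the equation for
  \<open>\<mu>s n\<close>: the residual tends to zero uniformly, and the contraction turns a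
  residual of size \<open>\<delta>\<close> into an error of at most
  \<open>2 / m\<^sup>2 * \<delta>\<close>. For the residuals pointwise convergence is enough, since
  integration against the kernel lands in a bounded subset of the RKHS. Square-integrable classes
  enter only at the end: the continuous solution provides one preimage under id - K, and injectivity
  on classes identifies it with the value of the inverse.\<close>

lemma riesz_representation:
  fixes L :: "'h::{real_inner, banach} \<Rightarrow> real"
  assumes L: "bounded_linear L"
  shows "\<exists>h. \<forall>v. h \<bullet> v = L v"
proof -
  interpret L: bounded_linear L by fact
  obtain B where B: "\<And>v. \<bar>L v\<bar> \<le> norm v * B"
    using L.bounded by (metis real_norm_def)
  \<comment> \<open>If \<open>h\<close> represents \<open>L\<close>, then \<open>F v\<close> is the
    squared distance from \<open>v\<close> to \<open>h\<close> minus the squared norm of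
    \<open>h\<close>; the representing vector is therefore sought as the minimiser of
    \<open>F\<close>.\<close>
  define F where "F v = (norm v)\<^sup>2 - 2 * L v" for v
  have lower: "- B\<^sup>2 \<le> F v" for v
  proof -
    have "0 \<le> (norm v - B)\<^sup>2" by simp
    moreover have "L v \<le> norm v * B" using B[of v] by simp
    ultimately show ?thesis unfolding F_def by (simp add: power2_diff)
  qed
  define d where "d = Inf (range F)"
  have bdd: "bdd_below (range F)" using lower by (auto intro!: bdd_belowI)
  have d_le: "d \<le> F v" for v unfolding d_def using bdd by (auto intro: cInf_lower)
  have "\<exists>v. F v < d + 1 / (real n + 1)" for n :: nat
  proof -
    have "Inf (range F) < d + 1 / (real n + 1)" unfolding d_def by simp
    then show ?thesis using cInf_lessD[of "range F"] by blast
  qed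
  then obtain u where u: "\<And>n::nat. F (u n) < d + 1 / (real n + 1)" by metis
  \<comment> \<open>By the parallelogram identity; the linear terms cancel at the midpoint, so
    minimising sequences are Cauchy.\<close>
  have par: "(norm (v - w))\<^sup>2 \<le> 2 * (F v - d) + 2 * (F w - d)" for v w
  proof -
    have "(norm (v - w))\<^sup>2 = 2 * F v + 2 * F w - 4 * F ((1/2) *\<^sub>R (v + w))"
      unfolding F_def power2_norm_eq_inner
      by (simp add: L.scaleR L.add inner_diff inner_add inner_commute)
        (simp add: field_simps)
    then show ?thesis using d_le[of "(1/2) *\<^sub>R (v + w)"] by simp
  qed
  have small: "(\<lambda>n. 1 / (real n + 1)) \<longlonglongrightarrow> 0"
    using LIMSEQ_inverse_real_of_nat by (simp add: inverse_eq_divide add.commute)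
  have "Cauchy u"
  proof (rule metric_CauchyI)
    fix e :: real assume e: "0 < e"
    then have "\<forall>\<^sub>F n in sequentially. 1 / (real n + 1) < e\<^sup>2 / 4"
      using order_tendstoD(2)[OF small, of "e\<^sup>2 / 4"] by simp
    then obtain M where M: "\<And>n. n \<ge> M \<Longrightarrow> 1 / (real n + 1) < e\<^sup>2 / 4"
      by (auto simp: eventually_sequentially)
    have near: "F (u p) - d < e\<^sup>2 / 4" if "p \<ge> M" for p
      using less_trans[OF _ M[OF that], of "F (u p) - d"] u[of p] by simp
    have "dist (u p) (u q) < e" if "p \<ge> M" "q \<ge> M" for p q
    proof -
      have "(norm (u p - u q))\<^sup>2 < e\<^sup>2"
        using par[of "u p" "u q"] near[OF that(1)] near[OF that(2)] by (simp add: field_simps)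
      then show ?thesis using e by (simp add: dist_norm power2_less_imp_less)
    qed
    then show "\<exists>M. \<forall>p\<ge>M. \<forall>q\<ge>M. dist (u p) (u q) < e" by blast
  qed
  then obtain h where h: "u \<longlonglongrightarrow> h" using Cauchy_convergent convergent_def by blast
  have "(\<lambda>n. F (u n)) \<longlonglongrightarrow> F h"
    unfolding F_def by (intro tendsto_intros h L.tendsto)
  moreover have "(\<lambda>n. d + 1 / (real n + 1)) \<longlonglongrightarrow> d" using tendsto_add[OF tendsto_const small] by simp
  ultimately have "F h \<le> d" by (rule LIMSEQ_le) (meson less_imp_le u)
  then have min: "F h \<le> F v" for v using d_le[of v] by linarith
  have "h \<bullet> v = L v" for v
  proof (rule ccontr)
    assume ne: "h \<bullet> v \<noteq> L v"
    \<comment> \<open>The optimal step along \<open>v\<close>, up to the summand 1, which avoids a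
      case distinction for \<open>v = 0\<close>. The step still lowers \<open>F\<close>
      strictly.\<close>
    define t where "t = (L v - h \<bullet> v) / (1 + v \<bullet> v)"
    have pos: "1 + v \<bullet> v > 0" using inner_ge_zero[of v] by linarith
    have "F (h + t *\<^sub>R v) - F h = t\<^sup>2 * (v \<bullet> v) - 2 * t * (L v - h \<bullet> v)"
      unfolding F_def by (simp add: L.scaleR L.add power2_norm_eq_inner inner_add inner_commute)
        (simp add: algebra_simps power2_eq_square)
    also have "\<dots> = t\<^sup>2 * (v \<bullet> v) - 2 * t\<^sup>2 * (1 + v \<bullet> v)"
      using pos by (simp add: t_def power2_eq_square)
    also have "\<dots> = - (t\<^sup>2 * (2 + v \<bullet> v))" by (simp add: algebra_simps)
    also have "\<dots> < 0"
    proof -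
      have "t \<noteq> 0" using ne pos by (simp add: t_def)
      moreover have "2 + v \<bullet> v > 0" using pos by linarith
      ultimately show ?thesis by simp
    qed
    finally show False using min[of "h + t *\<^sub>R v"] by linarith
  qed
  then show ?thesis by blast
qed

text \<open>The oscillation is blind to constants, so a fixed point can only be expected up to a
  constant \<open>l\<close>. Normalising to the value 0 at \<open>x0\<close> makes the supremum norm
  at most the oscillation, which brings Banach's theorem into reach.\<close>

lemma oscillation_contraction_fixpoint:
  fixes U :: "('a::metric_space \<Rightarrow> real) \<Rightarrow> 'a \<Rightarrow> real"
  assumes cpt: "compact (UNIV :: 'a set)"
    and cont: "\<And>\<phi>. continuous_on UNIV \<phi> \<Longrightarrow> continuous_on UNIV (U \<phi>)"
    and q: "0 \<le> q" "q < 1"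
    and contr: "\<And>\<phi> \<psi> D. continuous_on UNIV \<phi> \<Longrightarrow> continuous_on UNIV \<psi> \<Longrightarrow>
        (\<And>x y. (\<phi> x - \<psi> x) - (\<phi> y - \<psi> y) \<le> D) \<Longrightarrow>
        (\<And>x y. (U \<phi> x - U \<psi> x) - (U \<phi> y - U \<psi> y) \<le> q * D)"
  shows "\<exists>\<phi> l. continuous_on UNIV \<phi> \<and> (\<forall>x. U \<phi> x = \<phi> x + l)"
proof -
  fix x0 :: 'a
  have bc: "f \<in> bcontfun" if "continuous_on UNIV f" for f :: "'a \<Rightarrow> real"
    using that compact_imp_bounded[OF compact_continuous_image[OF that cpt]]
    by (simp add: bcontfun_def)
  define N where "N \<phi> = Bcontfun (\<lambda>x. U (apply_bcontfun \<phi>) x - U (apply_bcontfun \<phi>) x0)"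
    for \<phi> :: "'a \<Rightarrow>\<^sub>C real"
  have N: "apply_bcontfun (N \<phi>) x = U (apply_bcontfun \<phi>) x - U (apply_bcontfun \<phi>) x0" for \<phi> x
    unfolding N_def by (subst Bcontfun_inverse) (auto intro!: bc continuous_intros cont)
  have osc: "((N ^^ n) \<phi> x - (N ^^ n) \<psi> x) - ((N ^^ n) \<phi> y - (N ^^ n) \<psi> y)
      \<le> q ^ n * (2 * dist \<phi> \<psi>)" for n \<phi> \<psi> x y
  proof (induction n arbitrary: x y)
    case 0
    have "\<bar>\<phi> x - \<psi> x\<bar> \<le> dist \<phi> \<psi>" "\<bar>\<phi> y - \<psi> y\<bar> \<le> dist \<phi> \<psi>"
      using dist_bounded[of \<phi> _ \<psi>] by (auto simp: dist_real_def)
    then show ?case by simp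
  next
    case (Suc n)
    show ?case
      using contr[of "(N ^^ n) \<phi>" "(N ^^ n) \<psi>" "q ^ n * (2 * dist \<phi> \<psi>)" x y] Suc
      by (simp add: N mult.assoc)
  qed
  have "(\<lambda>n. q ^ n) \<longlonglongrightarrow> 0" using q by (rule LIMSEQ_realpow_zero)
  then have "\<forall>\<^sub>F n in sequentially. q ^ n < 1 / 2"
    using order_tendstoD(2)[of "\<lambda>n. q ^ n" 0 sequentially "1 / 2"] by simp
  then have "\<forall>\<^sub>F n in sequentially. 2 * q ^ n < 1" by eventually_elim simp
  \<comment> \<open>The factor 2 is the price of bounding the oscillation by the supremum norm.
    Since \<open>2 * q\<close> may exceed 1, an iterate is used; the exponent \<open>Suc n\<close>
    ensures at least one application of \<open>N\<close>, so that its values vanish at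
    \<open>x0\<close>.\<close>
  then obtain n where n: "2 * q ^ Suc n < 1"
    unfolding eventually_sequentially by (meson le_SucI order_refl)
  have "dist ((N ^^ Suc n) \<phi>) ((N ^^ Suc n) \<psi>) \<le> 2 * q ^ Suc n * dist \<phi> \<psi>" for \<phi> \<psi>
  proof (rule dist_bound)
    fix x
    have "(N ^^ Suc n) g x0 = 0" for g by (simp add: N)
    then show "dist ((N ^^ Suc n) \<phi> x) ((N ^^ Suc n) \<psi> x) \<le> 2 * q ^ Suc n * dist \<phi> \<psi>"
      using osc[of "Suc n" \<phi> x \<psi> x0] osc[of "Suc n" \<phi> x0 \<psi> x]
      by (simp add: dist_real_def abs_le_iff mult.commute mult.left_commute)
  qed
  then have ex1: "\<exists>!\<phi>. (N ^^ Suc n) \<phi> = \<phi>"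
    using q(1) by (intro banach_fix_type[OF _ n]) auto
  then obtain \<phi> where \<phi>: "(N ^^ Suc n) \<phi> = \<phi>" by blast
  \<comment> \<open>\<open>N\<close> commutes with its iterate and so permutes the fixed points of
    the iterate, of which there is only one.\<close>
  have "(N ^^ Suc n) (N \<phi>) = N ((N ^^ Suc n) \<phi>)" by (rule funpow_swap1[symmetric])
  then have "(N ^^ Suc n) (N \<phi>) = N \<phi>" unfolding \<phi> .
  then have "N \<phi> = \<phi>" using ex1 \<phi> by blast
  then have "U \<phi> x = \<phi> x + U \<phi> x0" for x using N[of \<phi> x] by simp
  then show ?thesis using continuous_on_apply_bcontfun by blast
qed

section \<open>Integration against Borel probability measures on a compact space\<close>

lemma borel_measurable_prob_measures:
  assumes "\<mu> \<in> prob_measures" "continuous_on UNIV f"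
  shows "f \<in> borel_measurable \<mu>"
  using assms borel_measurable_continuous_onI measurable_cong_sets unfolding prob_measures_def
  by blast

lemma bounded_continuous_compact:
  fixes f :: "'a::metric_space \<Rightarrow> real"
  assumes "compact (UNIV :: 'a set)" "continuous_on UNIV f"
  obtains C where "C > 0" "\<And>x. \<bar>f x\<bar> \<le> C"
  using compact_imp_bounded[OF compact_continuous_image[OF assms(2,1)]]
  by (auto simp: bounded_pos)

lemma integrable_mult_continuous:
  fixes f :: "'a::metric_space \<Rightarrow> real"
  assumes "compact (UNIV :: 'a set)" "\<mu> \<in> prob_measures" "continuous_on UNIV f" "integrable \<mu> F"
  shows "integrable \<mu> (\<lambda>x. F x * f x)"
proof -
  obtain C where C: "C > 0" "\<And>x. \<bar>f x\<bar> \<le> C"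
    using bounded_continuous_compact[OF assms(1,3)] by blast
  show ?thesis
  proof (rule Bochner_Integration.integrable_bound)
    show "integrable \<mu> (\<lambda>x. C * F x)" using assms by simp
    show "(\<lambda>x. F x * f x) \<in> borel_measurable \<mu>"
      using borel_measurable_prob_measures[OF assms(2,3)] assms(4) by auto
    show "AE x in \<mu>. norm (F x * f x) \<le> norm (C * F x)"
      using C by (auto simp: abs_mult mult.commute[of C] intro!: AE_I2 mult_left_mono)
  qed
qed

lemma integrable_continuous_prob:
  fixes f :: "'a::metric_space \<Rightarrow> real"
  assumes "compact (UNIV :: 'a set)" "\<mu> \<in> prob_measures" "continuous_on UNIV f"
  shows "integrable \<mu> f"
proof -
  interpret prob_space \<mu> using assms by (simp add: prob_measures_def)
  show ?thesis using integrable_mult_continuous[OF assms, of "\<lambda>_. 1"] by simp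
qed

lemma prob_integral_bounds:
  fixes f :: "'a::metric_space \<Rightarrow> real"
  assumes "\<mu> \<in> prob_measures" "integrable \<mu> f" "\<And>x. l \<le> f x" "\<And>x. f x \<le> u"
  shows "l \<le> (\<integral>x. f x \<partial>\<mu>)" "(\<integral>x. f x \<partial>\<mu>) \<le> u"
proof -
  interpret prob_space \<mu> using assms by (simp add: prob_measures_def)
  show "l \<le> (\<integral>x. f x \<partial>\<mu>)" "(\<integral>x. f x \<partial>\<mu>) \<le> u"
    using assms by (auto intro!: integral_ge_const integral_le_const)
qed

text \<open>Replacing \<open>gs n\<close> by \<open>g\<close> costs at most the supremum distance
  because every measure has mass one; weak-star convergence handles the fixed integrand
  \<open>g\<close>.\<close>

lemma weak_star_converges_uniform:
  fixes g :: "'a::metric_space \<Rightarrow> real"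
  assumes cpt: "compact (UNIV :: 'a set)" and mu: "\<And>n. \<mu>s n \<in> prob_measures"
    and conv: "weak_star_converges \<mu>s \<mu>"
    and gs: "\<And>n. continuous_on UNIV (gs n)" and g: "continuous_on UNIV g"
    and lim: "uniform_limit UNIV gs g sequentially"
  shows "(\<lambda>n. \<integral>x. gs n x \<partial>\<mu>s n) \<longlonglongrightarrow> (\<integral>x. g x \<partial>\<mu>)"
proof -
  have "(\<lambda>n. (\<integral>x. gs n x \<partial>\<mu>s n) - (\<integral>x. g x \<partial>\<mu>s n)) \<longlonglongrightarrow> 0"
  proof (rule tendstoI)
    fix e :: real assume "e > 0"
    then have "\<forall>\<^sub>F n in sequentially. \<forall>x\<in>UNIV. dist (gs n x) (g x) < e / 2"
      using uniform_limitD[OF lim, of "e / 2"] by simp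
    then show "\<forall>\<^sub>F n in sequentially.
        dist ((\<integral>x. gs n x \<partial>\<mu>s n) - (\<integral>x. g x \<partial>\<mu>s n)) 0 < e"
    proof eventually_elim
      case (elim n)
      have int: "integrable (\<mu>s n) (gs n)" "integrable (\<mu>s n) g"
        using integrable_continuous_prob[OF cpt mu] gs g by auto
      have "- (e/2) \<le> gs n x - g x" "gs n x - g x \<le> e/2" for x
        using elim[rule_format, OF UNIV_I, of x] unfolding dist_real_def abs_less_iff by linarith+
      from prob_integral_bounds[OF mu Bochner_Integration.integrable_diff[OF int] this]
      have "- (e/2) \<le> (\<integral>x. gs n x - g x \<partial>\<mu>s n)" "(\<integral>x. gs n x - g x \<partial>\<mu>s n) \<le> e/2" .
      then have "\<bar>(\<integral>x. gs n x \<partial>\<mu>s n) - (\<integral>x. g x \<partial>\<mu>s n)\<bar> \<le> e/2"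
        unfolding Bochner_Integration.integral_diff[OF int] abs_le_iff by linarith
      then show ?case using \<open>e > 0\<close> by simp
    qed
  qed
  moreover have "(\<lambda>n. \<integral>x. g x \<partial>\<mu>s n) \<longlonglongrightarrow> (\<integral>x. g x \<partial>\<mu>)"
    using conv g by (simp add: weak_star_converges_def)
  ultimately show ?thesis by (auto dest: tendsto_add)
qed

section \<open>The reproducing kernel Hilbert space\<close>

text \<open>The lower bound \<open>m\<close> is a parameter so that all constants below are visibly
  functions of the kernel bounds, never of the measure.\<close>

locale compact_rkhs =
  fixes k :: "'a::metric_space \<Rightarrow> 'a \<Rightarrow> real"
    and fun_of :: "'h::{real_inner, banach} \<Rightarrow> 'a \<Rightarrow> real"
    and m :: real
  assumes cpt: "compact (UNIV :: 'a set)"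
    and k_cont: "continuous_on UNIV (\<lambda>(x, y). k x y)"
    and k_sym: "k x y = k y x"
    and m_pos: "0 < m" and k_ge: "m \<le> k x y" and k_le: "k x y \<le> 1"
    and rkhs: "is_rkhs k fun_of"
begin

lemma k_pos: "0 < k x y"
  using m_pos k_ge[of x y] by linarith

lemma m_le_1: "m \<le> 1"
  using k_ge k_le order_trans by blast

lemma k_cont_left [continuous_intros]: "continuous_on UNIV (\<lambda>x. k x y)"
  using continuous_on_compose2[OF k_cont, of UNIV "\<lambda>x. (x, y)"]
  by (simp add: continuous_on_Pair)

definition sect :: "'a \<Rightarrow> 'h" where
  "sect x = (SOME h. fun_of h = k x \<and> (\<forall>v. v \<bullet> h = fun_of v x))"

lemma sect: "fun_of (sect x) = k x" "v \<bullet> sect x = fun_of v x"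
proof -
  have "\<exists>h. fun_of h = k x \<and> (\<forall>v. v \<bullet> h = fun_of v x)" using rkhs by (auto simp: is_rkhs_def)
  from someI_ex[OF this] show "fun_of (sect x) = k x" "v \<bullet> sect x = fun_of v x"
    unfolding sect_def by auto
qed

lemma fun_of_eqD: "fun_of g = fun_of h \<Longrightarrow> g = h"
  using rkhs by (auto simp: is_rkhs_def dest: injD)

lemma inner_sect: "sect x \<bullet> sect y = k x y"
  by (simp add: sect)

lemma fun_of_add: "fun_of (g + h) x = fun_of g x + fun_of h x"
  and fun_of_scaleR: "fun_of (r *\<^sub>R h) x = r * fun_of h x"
  by (simp_all add: inner_add_left flip: sect(2))

lemma abs_fun_of_le: "\<bar>fun_of h x\<bar> \<le> norm h"
proof -
  have "norm (sect x) \<le> 1"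
    using k_le[of x x] by (simp add: norm_eq_sqrt_inner inner_sect)
  then show ?thesis
    using Cauchy_Schwarz_ineq2[of h "sect x"] mult_left_mono[of "norm (sect x)" 1 "norm h"]
    by (simp add: sect)
qed

text \<open>The squared distance of \<open>sect x\<close> and \<open>sect y\<close> is k(x,x) - 2
  k(x,y) + k(y,y), small by uniform continuity of the kernel; Cauchy-Schwarz then gives one modulus
  of continuity for a whole ball of the space.\<close>

lemma fun_of_equicontinuous:
  assumes "e > 0"
  obtains d where "d > 0" "\<And>h x y. dist x y < d \<Longrightarrow> \<bar>fun_of h x - fun_of h y\<bar> \<le> e * norm h"
proof -
  have "compact (UNIV :: ('a \<times> 'a) set)" using compact_Times[OF cpt cpt] by simp
  then have "uniformly_continuous_on UNIV (\<lambda>(x, y). k x y)"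
    using compact_uniformly_continuous k_cont by blast
  then obtain d where d: "d > 0"
      "\<And>p q. dist p q < d \<Longrightarrow> dist ((\<lambda>(x, y). k x y) p) ((\<lambda>(x, y). k x y) q) < e\<^sup>2 / 2"
    unfolding uniformly_continuous_on_def using \<open>e > 0\<close>
    by (metis UNIV_I half_gt_zero zero_less_power)
  have "\<bar>fun_of h x - fun_of h y\<bar> \<le> e * norm h" if xy: "dist x y < d" for h x y
  proof -
    have "dist (x, x) (x, y) < d" "dist (y, y) (x, y) < d"
      using xy by (auto simp: dist_Pair_Pair dist_commute)
    from this[THEN d(2)] have "\<bar>k x x - k x y\<bar> < e\<^sup>2 / 2" "\<bar>k y y - k x y\<bar> < e\<^sup>2 / 2"
      by (simp_all add: dist_real_def)
    moreover have "(norm (sect x - sect y))\<^sup>2 = (k x x - k x y) + (k y y - k x y)"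
      by (simp add: power2_norm_eq_inner inner_diff inner_sect k_sym[of y x])
    ultimately have "(norm (sect x - sect y))\<^sup>2 \<le> e\<^sup>2" by linarith
    from power2_le_imp_le[OF this less_imp_le[OF \<open>e > 0\<close>]]
    have "norm h * norm (sect x - sect y) \<le> norm h * e" by (rule mult_left_mono) (rule norm_ge_zero)
    then have "\<bar>h \<bullet> (sect x - sect y)\<bar> \<le> norm h * e"
      using Cauchy_Schwarz_ineq2[of h "sect x - sect y"] by linarith
    then show ?thesis by (simp add: inner_diff_right sect mult.commute)
  qed
  then show ?thesis using that d(1) by blast
qed

lemma continuous_fun_of [continuous_intros]: "continuous_on UNIV (fun_of h)"
proof (rule uniformly_continuous_imp_continuous, unfold uniformly_continuous_on_def, intro allI impI)
  fix e :: real assume e: "0 < e"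
  have "0 < e / (norm h + 1)" using e by (simp add: add_nonneg_pos)
  then obtain d where d: "d > 0"
      "\<And>x y. dist x y < d \<Longrightarrow> \<bar>fun_of h x - fun_of h y\<bar> \<le> e / (norm h + 1) * norm h"
    using fun_of_equicontinuous by metis
  have "e / (norm h + 1) * norm h < e"
    using e by (simp add: divide_simps add_nonneg_pos)
  then show "\<exists>d>0. \<forall>x\<in>UNIV. \<forall>y\<in>UNIV. dist y x < d \<longrightarrow> dist (fun_of h y) (fun_of h x) < e"
    using d by (metis dist_real_def order_le_less_trans)
qed

text \<open>An Arzela-Ascoli argument: pointwise convergence is uniform on a finite net, and the
  common modulus of continuity carries it to all points. Weak convergence of bounded sequences
  enters through this lemma.\<close>

lemma uniform_limit_fun_of:
  assumes bdd: "\<forall>\<^sub>F n in sequentially. norm (h n) \<le> C"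
    and lim: "\<And>x. (\<lambda>n. fun_of (h n) x) \<longlonglongrightarrow> fun_of g x"
  shows "uniform_limit UNIV (\<lambda>n. fun_of (h n)) (fun_of g) sequentially"
proof (rule uniform_limitI)
  fix e :: real assume e: "0 < e"
  \<comment> \<open>The bound also covers the limit \<open>g\<close>, which needs the same modulus,
    and is made positive so that it can be divided by.\<close>
  define C' where "C' = max 1 (max C (norm g))"
  have C': "C' > 0" "C \<le> C'" "norm g \<le> C'" by (auto simp: C'_def)
  obtain d where d: "d > 0"
      "\<And>h x y. dist x y < d \<Longrightarrow> \<bar>fun_of h x - fun_of h y\<bar> \<le> e / (4 * C') * norm h"
    using fun_of_equicontinuous[of "e / (4 * C')"] e C' by auto
  have small: "\<bar>fun_of h x - fun_of h y\<bar> \<le> e / 4" if "dist x y < d" "norm h \<le> C'" for h x y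
  proof -
    have "e / (4 * C') * norm h \<le> e / (4 * C') * C'"
      using e C' that by (intro mult_left_mono) auto
    also have "\<dots> = e / 4" using C' by simp
    finally show ?thesis using d(2)[OF that(1), of h] by linarith
  qed
  have "UNIV \<subseteq> (\<Union>x::'a. ball x d)" using d(1) by auto
  then obtain S :: "'a set" where S: "finite S" "UNIV \<subseteq> (\<Union>x\<in>S. ball x d)"
    using compactE_image[OF cpt, of UNIV "\<lambda>x. ball x d"] by (metis open_ball)
  have "\<forall>\<^sub>F n in sequentially. \<forall>s\<in>S. \<bar>fun_of (h n) s - fun_of g s\<bar> < e / 4"
    using tendstoD[OF lim, of "e / 4"] e
    by (intro eventually_ball_finite S(1) ballI) (simp add: dist_real_def)
  with bdd show "\<forall>\<^sub>F n in sequentially. \<forall>x\<in>UNIV. dist (fun_of (h n) x) (fun_of g x) < e"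
  proof eventually_elim
    case (elim n)
    show ?case
    proof
      fix x
      have "x \<in> (\<Union>x\<in>S. ball x d)" using S(2) by blast
      then obtain s where s: "s \<in> S" "dist x s < d" by (auto simp: dist_commute)
      have "norm (h n) \<le> C'" using elim C' by linarith
      then have "\<bar>fun_of (h n) x - fun_of (h n) s\<bar> \<le> e / 4" using small s by blast
      moreover have "\<bar>fun_of g x - fun_of g s\<bar> \<le> e / 4" using small s C' by blast
      moreover have "\<bar>fun_of (h n) s - fun_of g s\<bar> < e / 4" using elim s by blast
      ultimately show "dist (fun_of (h n) x) (fun_of g x) < e"
        using e unfolding dist_real_def by linarith
    qed
  qed
qed

text \<open>The weak integral of \<open>F(x) k(x,\<cdot>)\<close> against \<open>\<mu>\<close>, as an element of the space.\<close>

definition emb :: "'a measure \<Rightarrow> ('a \<Rightarrow> real) \<Rightarrow> 'h" where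
  "emb \<mu> F = (SOME h. \<forall>v. h \<bullet> v = (\<integral>x. F x * fun_of v x \<partial>\<mu>))"

text \<open>Since \<open>\<bar>fun_of v x\<bar> \<le> norm v\<close>, the right-hand side is a
  functional of norm at most the integral of \<open>\<bar>F\<bar>\<close>, and Riesz representation
  applies.\<close>

lemma inner_emb:
  assumes mu: "\<mu> \<in> prob_measures" and F: "integrable \<mu> F"
  shows "emb \<mu> F \<bullet> v = (\<integral>x. F x * fun_of v x \<partial>\<mu>)"
proof -
  have int: "integrable \<mu> (\<lambda>x. F x * fun_of v x)" for v
    using integrable_mult_continuous[OF cpt mu continuous_fun_of F] .
  have "bounded_linear (\<lambda>v. \<integral>x. F x * fun_of v x \<partial>\<mu>)"
  proof (rule bounded_linear_intro)
    fix v w and r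
    show "(\<integral>x. F x * fun_of (v + w) x \<partial>\<mu>) = (\<integral>x. F x * fun_of v x \<partial>\<mu>) + (\<integral>x. F x * fun_of w x \<partial>\<mu>)"
      using int by (simp add: fun_of_add distrib_left)
    show "(\<integral>x. F x * fun_of (r *\<^sub>R v) x \<partial>\<mu>) = r *\<^sub>R (\<integral>x. F x * fun_of v x \<partial>\<mu>)"
      by (simp add: fun_of_scaleR mult.left_commute)
    have "norm (\<integral>x. F x * fun_of v x \<partial>\<mu>) \<le> (\<integral>x. norm (F x * fun_of v x) \<partial>\<mu>)" by simp
    also have "\<dots> \<le> (\<integral>x. \<bar>F x\<bar> * norm v \<partial>\<mu>)"
    proof (rule integral_mono)
      show "integrable \<mu> (\<lambda>x. norm (F x * fun_of v x))" using int by simp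
      show "integrable \<mu> (\<lambda>x. \<bar>F x\<bar> * norm v)" using F by simp
      show "norm (F x * fun_of v x) \<le> \<bar>F x\<bar> * norm v" for x
        unfolding real_norm_def abs_mult by (intro mult_left_mono abs_fun_of_le abs_ge_zero)
    qed
    finally have "norm (\<integral>x. F x * fun_of v x \<partial>\<mu>) \<le> (\<integral>x. \<bar>F x\<bar> * norm v \<partial>\<mu>)" .
    then show "norm (\<integral>x. F x * fun_of v x \<partial>\<mu>) \<le> norm v * (\<integral>x. \<bar>F x\<bar> \<partial>\<mu>)"
      by (simp add: mult.commute)
  qed
  from someI_ex[OF riesz_representation[OF this]] show ?thesis unfolding emb_def by blast
qed

lemma fun_of_emb:
  assumes "\<mu> \<in> prob_measures" "integrable \<mu> F"
  shows "fun_of (emb \<mu> F) y = (\<integral>x. F x * k x y \<partial>\<mu>)"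
  using inner_emb[OF assms, of "sect y"] by (simp add: sect k_sym[of y])

text \<open>Obtained by testing the embedded function against itself. The bound is independent of
  the measure and provides the norm bound in \<open>uniform_limit_emb\<close>.\<close>

lemma norm_emb_le:
  assumes mu: "\<mu> \<in> prob_measures" and F: "integrable \<mu> F" and C: "\<And>x. \<bar>F x\<bar> \<le> C"
  shows "norm (emb \<mu> F) \<le> C"
proof -
  let ?h = "emb \<mu> F"
  have C0: "0 \<le> C" using C abs_ge_zero order_trans by blast
  have "norm ?h * norm ?h = (\<integral>x. F x * fun_of ?h x \<partial>\<mu>)"
    using inner_emb[OF mu F, of ?h] by (simp add: power2_norm_eq_inner flip: power2_eq_square)
  also have "\<dots> \<le> C * norm ?h"
  proof (rule prob_integral_bounds[OF mu])
    show "integrable \<mu> (\<lambda>x. F x * fun_of ?h x)"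
      using integrable_mult_continuous[OF cpt mu continuous_fun_of F] .
    have "\<bar>F x * fun_of ?h x\<bar> \<le> C * norm ?h" for x
      unfolding abs_mult using C C0 abs_fun_of_le by (intro mult_mono) auto
    then show "F x * fun_of ?h x \<le> C * norm ?h" "- (C * norm ?h) \<le> F x * fun_of ?h x" for x
      by (simp_all add: abs_le_iff minus_le_iff)
  qed
  finally show ?thesis using C0 by (cases "norm ?h = 0") auto
qed

lemma uniform_limit_emb:
  assumes mu: "\<And>n. \<mu>s n \<in> prob_measures" "\<mu> \<in> prob_measures"
    and conv: "weak_star_converges \<mu>s \<mu>"
    and Fs: "\<And>n. continuous_on UNIV (Fs n)" and F: "continuous_on UNIV F"
    and lim: "uniform_limit UNIV Fs F sequentially"
  shows "uniform_limit UNIV (\<lambda>n. fun_of (emb (\<mu>s n) (Fs n))) (fun_of (emb \<mu> F)) sequentially"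
proof -
  note int = integrable_continuous_prob[OF cpt]
  obtain C where C: "\<And>x. \<bar>F x\<bar> \<le> C" using bounded_continuous_compact[OF cpt F] by blast
  have "\<forall>\<^sub>F n in sequentially. \<forall>x\<in>UNIV. dist (Fs n x) (F x) < 1"
    using uniform_limitD[OF lim] by simp
  then have bdd: "\<forall>\<^sub>F n in sequentially. norm (emb (\<mu>s n) (Fs n)) \<le> C + 1"
  proof eventually_elim
    case (elim n)
    have "\<bar>Fs n x\<bar> \<le> C + 1" for x
      using elim[rule_format, OF UNIV_I, of x] C[of x] unfolding dist_real_def by linarith
    then show ?case using norm_emb_le[OF mu(1) int[OF mu(1) Fs]] by blast
  qed
  have "(\<lambda>n. fun_of (emb (\<mu>s n) (Fs n)) y) \<longlonglongrightarrow> fun_of (emb \<mu> F) y" for y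
  proof -
    obtain D where D: "\<And>x. \<bar>k x y\<bar> \<le> D"
      using bounded_continuous_compact[OF cpt k_cont_left] by blast
    have "uniform_limit UNIV (\<lambda>n x. Fs n x * k x y) (\<lambda>x. F x * k x y) sequentially"
      using C D by (intro uniform_lim_mult lim uniform_limit_const) (auto intro!: boundedI)
    then have "(\<lambda>n. \<integral>x. Fs n x * k x y \<partial>\<mu>s n) \<longlonglongrightarrow> (\<integral>x. F x * k x y \<partial>\<mu>)"
      using Fs F by (intro weak_star_converges_uniform[OF cpt mu(1) conv])
        (auto intro!: continuous_intros)
    then show ?thesis
      using fun_of_emb[OF mu(1) int[OF mu(1) Fs]] fun_of_emb[OF mu(2) int[OF mu(2) F]] by simp
  qed
  with bdd show ?thesis by (rule uniform_limit_fun_of)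
qed

text \<open>Both sides are the inner product of the two embedded functions, so that Fubini's theorem is
  not needed.\<close>

lemma emb_symmetric:
  assumes "\<mu> \<in> prob_measures" "integrable \<mu> F" "integrable \<mu> G"
  shows "(\<integral>x. G x * fun_of (emb \<mu> F) x \<partial>\<mu>) = (\<integral>x. F x * fun_of (emb \<mu> G) x \<partial>\<mu>)"
  using inner_emb[OF assms(1,2)] inner_emb[OF assms(1,3)] by (metis inner_commute)

end

text \<open>By compactness \<open>g\<close> stays away from \<open>l\<close>, so the
  \<open>gs n\<close> eventually take values in a compact interval on which \<open>f\<close> is
  uniformly continuous. This is applied to \<open>ln\<close> and \<open>exp\<close>.\<close>

lemma uniform_limit_compose_real:
  fixes g :: "'a::metric_space \<Rightarrow> real" and f :: "real \<Rightarrow> real"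
  assumes cpt: "compact (UNIV :: 'a set)" and g: "continuous_on UNIV g"
    and l: "\<And>x. l < g x" and f: "continuous_on {l<..} f"
    and lim: "uniform_limit UNIV gs g sequentially"
  shows "uniform_limit UNIV (\<lambda>n x. f (gs n x)) (\<lambda>x. f (g x)) sequentially"
proof -
  obtain z where z: "\<And>x. g z \<le> g x" using continuous_attains_inf[OF cpt _ g] by auto
  obtain C where C: "\<And>x. \<bar>g x\<bar> \<le> C" using bounded_continuous_compact[OF cpt g] by blast
  define b where "b = (l + g z) / 2"
  have b: "l < b" "b < g z" using l[of z] by (auto simp: b_def)
  have "uniformly_continuous_on {b..C + 1} f"
    using b by (intro compact_uniformly_continuous continuous_on_subset[OF f]) auto
  moreover have "\<forall>\<^sub>F n in sequentially. \<forall>x\<in>UNIV. gs n x \<in> {b..C + 1}"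
  proof -
    have "\<forall>\<^sub>F n in sequentially. \<forall>x\<in>UNIV. dist (gs n x) (g x) < min 1 (g z - b)"
      using uniform_limitD[OF lim, of "min 1 (g z - b)"] b by simp
    then show ?thesis
    proof eventually_elim
      case (elim n)
      have "gs n x \<in> {b..C + 1}" for x
        using elim[rule_format, OF UNIV_I, of x] z[of x] C[of x]
        unfolding dist_real_def atLeastAtMost_iff by (intro conjI; linarith)
      then show ?case by blast
    qed
  qed
  ultimately show ?thesis
    by (intro uniform_limit_compose_uniformly_continuous_on[OF lim]) auto
qed

section \<open>The self-transport potential\<close>

context compact_rkhs
begin

lemma fun_of_emb_mono:
  assumes mu: "\<mu> \<in> prob_measures" and int: "integrable \<mu> F" "integrable \<mu> G"
    and le: "\<And>x. F x \<le> G x"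
  shows "fun_of (emb \<mu> F) y \<le> fun_of (emb \<mu> G) y"
  unfolding fun_of_emb[OF mu int(1)] fun_of_emb[OF mu int(2)]
  using less_imp_le[OF k_pos] le
  by (intro integral_mono integrable_mult_continuous[OF cpt mu k_cont_left] int mult_right_mono)

lemma fun_of_emb_cmult:
  assumes mu: "\<mu> \<in> prob_measures" and int: "integrable \<mu> F"
  shows "fun_of (emb \<mu> (\<lambda>x. r * F x)) y = r * fun_of (emb \<mu> F) y"
  using int by (simp add: fun_of_emb[OF mu] mult.assoc)

lemma fun_of_emb_diff:
  assumes mu: "\<mu> \<in> prob_measures" and int: "integrable \<mu> F" "integrable \<mu> G"
  shows "fun_of (emb \<mu> (\<lambda>x. F x - G x)) y = fun_of (emb \<mu> F) y - fun_of (emb \<mu> G) y"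
  using int integrable_mult_continuous[OF cpt mu k_cont_left]
  by (simp add: fun_of_emb[OF mu] left_diff_distrib)

text \<open>From k(x,y) \<open>\<ge>\<close> m \<open>\<ge>\<close> m k(x,y'), integrated against a
  nonnegative density.\<close>

lemma fun_of_emb_harnack:
  assumes mu: "\<mu> \<in> prob_measures" and F: "integrable \<mu> F" "\<And>x. 0 \<le> F x"
  shows "m * fun_of (emb \<mu> F) y' \<le> fun_of (emb \<mu> F) y"
proof -
  have "m * k x y' \<le> k x y" for x
    using mult_left_mono[OF k_le[of x y'] less_imp_le[OF m_pos]] k_ge[of x y] by simp
  then have "F x * (m * k x y') \<le> F x * k x y" for x using F(2) by (rule mult_left_mono)
  then have "(\<integral>x. F x * (m * k x y') \<partial>\<mu>) \<le> (\<integral>x. F x * k x y \<partial>\<mu>)"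
    by (intro integral_mono integrable_mult_continuous[OF cpt mu _ F(1)] continuous_intros k_cont_left)
  then show ?thesis by (simp add: fun_of_emb[OF mu F(1)] mult.left_commute)
qed

lemma fun_of_emb_pos:
  assumes mu: "\<mu> \<in> prob_measures" and F: "continuous_on UNIV F" "\<And>x. 0 < F x"
  shows "0 < fun_of (emb \<mu> F) y"
proof -
  obtain z where z: "\<And>x. F z \<le> F x" using continuous_attains_inf[OF cpt _ F(1)] by auto
  have "F z * m \<le> F x * k x y" for x
    using z F(2) m_pos k_ge by (intro mult_mono) (auto intro: less_imp_le)
  moreover obtain C where "\<And>x. \<bar>F x * k x y\<bar> \<le> C"
    using bounded_continuous_compact[OF cpt continuous_on_mult[OF F(1) k_cont_left]] by blast
  then have "F x * k x y \<le> C" for x by (simp add: abs_le_iff)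
  ultimately have "F z * m \<le> fun_of (emb \<mu> F) y"
    unfolding fun_of_emb[OF mu integrable_continuous_prob[OF cpt mu F(1)]]
    by (rule prob_integral_bounds[OF mu
          integrable_continuous_prob[OF cpt mu continuous_on_mult[OF F(1) k_cont_left]]])
  moreover have "0 < F z * m" using F m_pos by simp
  ultimately show ?thesis by linarith
qed

section \<open>The Sinkhorn map in logarithmic form\<close>

text \<open>With a = exp \<open>\<phi>\<close>, the equation
  \<open>sinkhorn \<mu> \<phi> = \<phi>\<close> says that a(y) times the integral of a k(.,y) is 1;
  this is the self-transport equation for \<open>\<phi>\<close> equal to the potential divided by
  \<open>\<epsilon>\<close>.\<close>

definition sinkhorn :: "'a measure \<Rightarrow> ('a \<Rightarrow> real) \<Rightarrow> 'a \<Rightarrow> real" where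
  "sinkhorn \<mu> \<phi> y = - ln (fun_of (emb \<mu> (\<lambda>x. exp (\<phi> x))) y)"

context
  fixes \<mu> :: "'a measure"
  assumes mu: "\<mu> \<in> prob_measures"
begin

lemma exp_emb_pos: "continuous_on UNIV \<phi> \<Longrightarrow> 0 < fun_of (emb \<mu> (\<lambda>x. exp (\<phi> x))) y"
  by (intro fun_of_emb_pos mu continuous_intros) auto

lemma exp_integrable: "continuous_on UNIV \<phi> \<Longrightarrow> integrable \<mu> (\<lambda>x. exp (\<phi> x) :: real)"
  by (intro integrable_continuous_prob[OF cpt mu] continuous_intros)

lemma continuous_sinkhorn: "continuous_on UNIV \<phi> \<Longrightarrow> continuous_on UNIV (sinkhorn \<mu> \<phi>)"
  unfolding sinkhorn_def using exp_emb_pos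
  by (intro continuous_intros) (auto simp: less_imp_neq[symmetric])

lemma emb_exp_le:
  assumes "continuous_on UNIV \<phi>" "continuous_on UNIV \<psi>" "\<And>x. \<phi> x \<le> \<psi> x + s"
  shows "fun_of (emb \<mu> (\<lambda>x. exp (\<phi> x))) y \<le> exp s * fun_of (emb \<mu> (\<lambda>x. exp (\<psi> x))) y"
proof -
  have "exp (\<phi> x) \<le> exp s * exp (\<psi> x)" for x
    using assms(3)[of x] by (simp flip: exp_add add: add.commute)
  then show ?thesis
    using fun_of_emb_mono[OF mu exp_integrable[OF assms(1)] integrable_mult_right[OF exp_integrable[OF assms(2)]]]
    by (simp add: fun_of_emb_cmult[OF mu exp_integrable[OF assms(2)]])
qed

text \<open>The map reverses order and turns a shift by \<open>s\<close> into a shift by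
  \<open>- s\<close>. This pins down the additive constant, about which the oscillation says
  nothing.\<close>

lemma sinkhorn_antimono:
  assumes "continuous_on UNIV \<phi>" "continuous_on UNIV \<psi>" "\<And>x. \<phi> x \<le> \<psi> x + s"
  shows "sinkhorn \<mu> \<psi> y \<le> sinkhorn \<mu> \<phi> y + s"
proof -
  have "ln (fun_of (emb \<mu> (\<lambda>x. exp (\<phi> x))) y) \<le> ln (exp s * fun_of (emb \<mu> (\<lambda>x. exp (\<psi> x))) y)"
    using emb_exp_le[OF assms] exp_emb_pos[OF assms(1)] exp_emb_pos[OF assms(2)]
    by (intro ln_mono) auto
  also have "\<dots> = s + ln (fun_of (emb \<mu> (\<lambda>x. exp (\<psi> x))) y)"
    using exp_emb_pos[OF assms(2)] by (simp add: ln_mult_pos)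
  finally show ?thesis by (simp add: sinkhorn_def)
qed

text \<open>Birkhoff's contraction of the Hilbert projective metric. If \<open>r \<le> \<phi> - \<psi> \<le> r + D\<close>, the Harnack
  inequality gives \<open>R(y) \<ge> m\<^sup>2 R(y') + (1 - m\<^sup>2) e\<^sup>r\<close> for the quotient \<open>R\<close> of the two integrals,
  and convexity of \<open>exp\<close> turns this into a bound on \<open>ln R\<close>.\<close>

lemma sinkhorn_contraction:
  assumes \<phi>: "continuous_on UNIV \<phi>" and \<psi>: "continuous_on UNIV \<psi>"
    and D: "\<And>x y. (\<phi> x - \<psi> x) - (\<phi> y - \<psi> y) \<le> D"
  shows "(sinkhorn \<mu> \<phi> y - sinkhorn \<mu> \<psi> y) - (sinkhorn \<mu> \<phi> y' - sinkhorn \<mu> \<psi> y') \<le> (1 - m\<^sup>2) * D"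
proof -
  obtain z where z: "\<And>x. \<phi> z - \<psi> z \<le> \<phi> x - \<psi> x"
    using continuous_attains_inf[OF cpt _ continuous_on_diff[OF \<phi> \<psi>]] by auto
  define r where "r = \<phi> z - \<psi> z"
  define A where "A = fun_of (emb \<mu> (\<lambda>x. exp (\<phi> x)))"
  define B where "B = fun_of (emb \<mu> (\<lambda>x. exp (\<psi> x)))"
  have pos: "0 < A y" "0 < B y" for y
    unfolding A_def B_def using exp_emb_pos[OF \<phi>] exp_emb_pos[OF \<psi>] by auto
  note int = exp_integrable[OF \<phi>] exp_integrable[OF \<psi>]
  have hB: "m * B y \<le> B y'"
    unfolding B_def by (rule fun_of_emb_harnack[OF mu int(2)]) simp
  have "0 \<le> exp (\<phi> x) - exp r * exp (\<psi> x)" for x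
    using z[of x] by (simp add: r_def flip: exp_add)
  with int have "m * fun_of (emb \<mu> (\<lambda>x. exp (\<phi> x) - exp r * exp (\<psi> x))) y'
      \<le> fun_of (emb \<mu> (\<lambda>x. exp (\<phi> x) - exp r * exp (\<psi> x))) y"
    by (intro fun_of_emb_harnack[OF mu]) auto
  then have hA: "m * (A y' - exp r * B y') \<le> A y - exp r * B y"
    using int by (simp add: A_def B_def fun_of_emb_diff[OF mu] fun_of_emb_cmult[OF mu])
  have "\<psi> x \<le> \<phi> x + (- r)" "\<phi> x \<le> \<psi> x + (r + D)" for x
    using z[of x] D[of x z] by (auto simp: r_def)
  from emb_exp_le[OF \<psi> \<phi> this(1), of y'] emb_exp_le[OF \<phi> \<psi> this(2), of y']
  have lo: "exp r * B y' \<le> A y'" and hi: "A y' \<le> exp (r + D) * B y'"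
    by (simp_all add: A_def B_def exp_minus field_simps)
  define s where "s = ln (A y' / B y')"
  have es: "exp s = A y' / B y'" using pos by (simp add: s_def)
  have "s \<le> ln (exp (r + D))"
    unfolding s_def using hi pos by (intro ln_mono) (simp_all add: field_simps)
  then have s: "s \<le> r + D" by simp
  \<comment> \<open>One factor \<open>m\<close> is spent on the denominator (\<open>hB\<close>) and
    one on the excess of the numerator (\<open>hA\<close>); hence the square in the contraction
    constant.\<close>
  have "m\<^sup>2 * (exp s - exp r) * B y = m * ((exp s - exp r) * (m * B y))"
    by (simp add: power2_eq_square)
  also have "\<dots> \<le> m * ((exp s - exp r) * B y')"
    using hB lo pos[of y'] m_pos by (intro mult_left_mono) (auto simp: es field_simps)
  also have "\<dots> = m * (A y' - exp r * B y')"
    using pos[of y'] by (simp add: es field_simps)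
  also have "\<dots> \<le> (A y / B y - exp r) * B y"
    using hA pos(2)[of y] by (simp add: left_diff_distrib)
  finally have "m\<^sup>2 * (exp s - exp r) \<le> A y / B y - exp r" using pos(2)[of y] by simp
  moreover have "exp ((1 - m\<^sup>2) *\<^sub>R r + m\<^sup>2 *\<^sub>R s) \<le> (1 - m\<^sup>2) * exp r + m\<^sup>2 * exp s"
    using m_pos m_le_1 by (intro convex_onD[OF exp_convex]) (auto simp: power_le_one)
  ultimately have "exp ((1 - m\<^sup>2) * r + m\<^sup>2 * s) \<le> A y / B y" by (simp add: algebra_simps)
  then have "(1 - m\<^sup>2) * r + m\<^sup>2 * s \<le> ln (A y / B y)" using pos by (simp add: ln_ge_iff)
  moreover have "(1 - m\<^sup>2) * (s - r) \<le> (1 - m\<^sup>2) * D"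
    using s m_pos m_le_1 by (intro mult_left_mono) (auto simp: power_le_one)
  ultimately have "s - ln (A y / B y) \<le> (1 - m\<^sup>2) * D" by (simp add: algebra_simps)
  then show ?thesis
    using pos by (simp add: s_def sinkhorn_def ln_divide_pos flip: A_def B_def)
qed

lemma sinkhorn_fixpoint: "\<exists>\<phi>. continuous_on UNIV \<phi> \<and> sinkhorn \<mu> \<phi> = \<phi>"
proof -
  have "0 \<le> 1 - m\<^sup>2" "1 - m\<^sup>2 < 1" using m_pos m_le_1 by (auto simp: power_le_one)
  then obtain \<phi> l where \<phi>: "continuous_on UNIV \<phi>" "\<And>x. sinkhorn \<mu> \<phi> x = \<phi> x + l"
    using oscillation_contraction_fixpoint[where U = "sinkhorn \<mu>", OF cpt continuous_sinkhorn _ _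
        sinkhorn_contraction] by blast
  \<comment> \<open>Raising the argument by \<open>l / 2\<close> lowers the image by
    \<open>l / 2\<close>, which absorbs the defect \<open>l\<close>.\<close>
  let ?\<psi> = "\<lambda>x. \<phi> x + l / 2"
  have \<psi>: "continuous_on UNIV ?\<psi>" using \<phi>(1) by (intro continuous_intros)
  have "sinkhorn \<mu> ?\<psi> x = ?\<psi> x" for x
    using sinkhorn_antimono[OF \<phi>(1) \<psi>, of "- l / 2" x] sinkhorn_antimono[OF \<psi> \<phi>(1), of "l / 2" x] \<phi>(2)[of x]
    by simp
  then show ?thesis using \<psi> by blast
qed

text \<open>The contraction bounds the oscillation of \<open>\<phi> - \<psi>\<close> by
  \<open>2 * \<delta> / m\<^sup>2\<close>, while order reversal shows that its maximum
  \<open>s\<close> and minimum \<open>r\<close> satisfy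
  \<open>\<bar>r + s\<bar> \<le> \<delta>\<close>; together they bound the difference itself. With
  \<open>\<delta> = 0\<close> this is uniqueness, with a small \<open>\<delta>\<close> it is
  continuity in the measure.\<close>

lemma sinkhorn_stability:
  assumes \<phi>: "continuous_on UNIV \<phi>" "sinkhorn \<mu> \<phi> = \<phi>"
    and \<psi>: "continuous_on UNIV \<psi>" "\<And>y. \<bar>\<psi> y - sinkhorn \<mu> \<psi> y\<bar> \<le> \<delta>"
  shows "\<bar>\<phi> x - \<psi> x\<bar> \<le> 2 / m\<^sup>2 * \<delta>"
proof -
  note u = continuous_on_diff[OF \<phi>(1) \<psi>(1)]
  obtain z where z: "\<And>x. \<phi> z - \<psi> z \<le> \<phi> x - \<psi> x" using continuous_attains_inf[OF cpt _ u] by auto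
  obtain w where w: "\<And>x. \<phi> x - \<psi> x \<le> \<phi> w - \<psi> w" using continuous_attains_sup[OF cpt _ u] by auto
  define r where "r = \<phi> z - \<psi> z"
  define s where "s = \<phi> w - \<psi> w"
  have "(\<phi> x - \<psi> x) - (\<phi> y - \<psi> y) \<le> s - r" for x y
    using w[of x] z[of y] by (simp add: r_def s_def)
  from sinkhorn_contraction[OF \<phi>(1) \<psi>(1) this, of w z]
  have "s - r \<le> (1 - m\<^sup>2) * (s - r) + 2 * \<delta>"
    using \<psi>(2)[of w] \<psi>(2)[of z] unfolding \<phi>(2) r_def s_def abs_le_iff by linarith
  then have osc: "m\<^sup>2 * (s - r) \<le> 2 * \<delta>" by (simp add: algebra_simps)
  have "\<phi> x \<le> \<psi> x + s" "\<psi> x \<le> \<phi> x + (- r)" for x using w[of x] z[of x] by (simp_all add: r_def s_def)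
  from sinkhorn_antimono[OF \<phi>(1) \<psi>(1) this(1), of z] sinkhorn_antimono[OF \<psi>(1) \<phi>(1) this(2), of w]
  have sum: "- r \<le> s + \<delta>" "s \<le> - r + \<delta>"
    using \<psi>(2)[of w] \<psi>(2)[of z] unfolding \<phi>(2) r_def s_def abs_le_iff by linarith+
  have m2: "0 < m\<^sup>2" "m\<^sup>2 \<le> 1" using m_pos m_le_1 by (auto simp: power_le_one)
  have "0 \<le> \<delta>" using \<psi>(2)[of x] by linarith
  then have "m\<^sup>2 * \<delta> \<le> \<delta>" using m2 mult_right_mono[of "m\<^sup>2" 1 \<delta>] by simp
  moreover have "2 * (m\<^sup>2 * \<bar>\<phi> x - \<psi> x\<bar>) \<le> m\<^sup>2 * (s - r + \<delta>)"
  proof -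
    have "\<phi> x - \<psi> x \<le> s" "r \<le> \<phi> x - \<psi> x" using w z by (simp_all add: r_def s_def)
    with sum have "\<bar>\<phi> x - \<psi> x\<bar> \<le> (s - r + \<delta>) / 2"
      by (intro abs_leI) (simp_all add: field_simps)
    then have "2 * \<bar>\<phi> x - \<psi> x\<bar> \<le> s - r + \<delta>" by simp
    from mult_left_mono[OF this, of "m\<^sup>2"] show ?thesis by simp
  qed
  ultimately have "m\<^sup>2 * \<bar>\<phi> x - \<psi> x\<bar> \<le> 2 * \<delta>"
    using osc \<open>0 \<le> \<delta>\<close> by (simp add: distrib_left)
  then show ?thesis using m2 by (simp add: field_simps)
qed

end

section \<open>The potential and its dependence on the measure\<close>

definition potential :: "'a measure \<Rightarrow> 'a \<Rightarrow> real" where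
  "potential \<mu> = (SOME \<phi>. continuous_on UNIV \<phi> \<and> sinkhorn \<mu> \<phi> = \<phi>)"

definition scal :: "'a measure \<Rightarrow> 'a \<Rightarrow> real" where
  "scal \<mu> x = exp (potential \<mu> x)"

lemma potential:
  assumes "\<mu> \<in> prob_measures"
  shows "continuous_on UNIV (potential \<mu>)" "sinkhorn \<mu> (potential \<mu>) = potential \<mu>"
  using someI_ex[OF sinkhorn_fixpoint[OF assms]] unfolding potential_def by auto

lemma potential_unique:
  assumes "\<mu> \<in> prob_measures" "continuous_on UNIV \<phi>" "sinkhorn \<mu> \<phi> = \<phi>"
  shows "\<phi> = potential \<mu>"
  using sinkhorn_stability[OF assms(1) potential[OF assms(1)] assms(2), of 0] assms(3)
  by auto

lemma scal_pos: "0 < scal \<mu> x"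
  by (simp add: scal_def)

lemma continuous_scal: "\<mu> \<in> prob_measures \<Longrightarrow> continuous_on UNIV (scal \<mu>)"
  unfolding scal_def by (intro continuous_intros potential)

lemma integrable_scal: "\<mu> \<in> prob_measures \<Longrightarrow> integrable \<mu> (scal \<mu>)"
  by (intro integrable_continuous_prob[OF cpt] continuous_scal)

lemma scal_emb:
  assumes mu: "\<mu> \<in> prob_measures"
  shows "scal \<mu> y * fun_of (emb \<mu> (scal \<mu>)) y = 1"
proof -
  have "potential \<mu> y = - ln (fun_of (emb \<mu> (scal \<mu>)) y)"
    using fun_cong[OF potential(2)[OF mu], of y] by (simp add: sinkhorn_def scal_def[abs_def])
  moreover have "0 < fun_of (emb \<mu> (scal \<mu>)) y"
    by (rule fun_of_emb_pos[OF mu continuous_scal[OF mu] scal_pos])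
  ultimately show ?thesis by (simp add: scal_def exp_minus)
qed

lemma uniform_limit_scal:
  assumes mu: "\<And>n. \<mu>s n \<in> prob_measures" "\<mu> \<in> prob_measures"
    and conv: "weak_star_converges \<mu>s \<mu>"
  shows "uniform_limit UNIV (\<lambda>n. scal (\<mu>s n)) (scal \<mu>) sequentially"
proof -
  let ?\<psi> = "potential \<mu>"
  have e: "continuous_on UNIV (\<lambda>x. exp (?\<psi> x))" by (intro continuous_intros potential mu)
  have "uniform_limit UNIV (\<lambda>n. fun_of (emb (\<mu>s n) (\<lambda>x. exp (?\<psi> x))))
      (fun_of (emb \<mu> (\<lambda>x. exp (?\<psi> x)))) sequentially"
    by (intro uniform_limit_emb mu conv e uniform_limit_const)
  from uniform_limit_compose_real[OF cpt continuous_fun_of exp_emb_pos[OF mu(2) potential(1)[OF mu(2)]] _ this, of ln]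
  have "uniform_limit UNIV (\<lambda>n y. ln (fun_of (emb (\<mu>s n) (\<lambda>x. exp (?\<psi> x))) y))
      (\<lambda>y. ln (fun_of (emb \<mu> (\<lambda>x. exp (?\<psi> x))) y)) sequentially"
    by (simp add: continuous_on_ln)
  \<comment> \<open>Since \<open>?\<psi>\<close> is fixed by \<open>sinkhorn \<mu>\<close>, this
    says that its residual under \<open>sinkhorn (\<mu>s n)\<close> vanishes uniformly, which is the
    input of \<open>sinkhorn_stability\<close>.\<close>
  then have T: "uniform_limit UNIV (\<lambda>n. sinkhorn (\<mu>s n) ?\<psi>) (sinkhorn \<mu> ?\<psi>) sequentially"
    unfolding sinkhorn_def by (rule uniform_limit_uminus)
  have "uniform_limit UNIV (\<lambda>n. potential (\<mu>s n)) ?\<psi> sequentially"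
  proof (rule uniform_limitI)
    fix e :: real assume e: "e > 0"
    define \<delta> where "\<delta> = e * m\<^sup>2 / 4"
    have \<delta>: "0 < \<delta>" "2 / m\<^sup>2 * \<delta> < e" using e m_pos by (auto simp: \<delta>_def)
    from uniform_limitD[OF T \<delta>(1)]
    show "\<forall>\<^sub>F n in sequentially. \<forall>x\<in>UNIV. dist (potential (\<mu>s n) x) (?\<psi> x) < e"
    proof eventually_elim
      case (elim n)
      have "\<bar>?\<psi> y - sinkhorn (\<mu>s n) ?\<psi> y\<bar> \<le> \<delta>" for y
        using elim[rule_format, OF UNIV_I, of y] unfolding potential(2)[OF mu(2)] dist_real_def
        by linarith
      from sinkhorn_stability[OF mu(1) potential[OF mu(1)] potential(1)[OF mu(2)] this]
      have "\<bar>potential (\<mu>s n) x - ?\<psi> x\<bar> \<le> 2 / m\<^sup>2 * \<delta>" for x .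
      then show ?case using \<delta>(2) unfolding dist_real_def by (meson order_le_less_trans)
    qed
  qed
  note lim = this
  obtain C where C: "\<And>x. \<bar>?\<psi> x\<bar> \<le> C"
    using bounded_continuous_compact[OF cpt potential(1)[OF mu(2)]] by blast
  have "- C - 1 < ?\<psi> x" for x using C[of x] by linarith
  from uniform_limit_compose_real[OF cpt potential(1)[OF mu(2)] this _ lim, of exp]
  show ?thesis unfolding scal_def by (simp add: continuous_on_exp continuous_on_id)
qed

end

lemma uniform_limit_mult_continuous:
  fixes f g :: "'a::metric_space \<Rightarrow> real"
  assumes cpt: "compact (UNIV :: 'a set)" and "continuous_on UNIV f" "continuous_on UNIV g"
    and "uniform_limit UNIV fs f F" "uniform_limit UNIV gs g F"
  shows "uniform_limit UNIV (\<lambda>n x. fs n x * gs n x) (\<lambda>x. f x * g x) F"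
  using assms by (intro uniform_lim_mult compact_imp_bounded compact_continuous_image) auto

section \<open>The self-transport Markov operator\<close>

context compact_rkhs
begin

text \<open>The operator \<open>K\<^sub>\<mu>\<close> factored through the RKHS, so that its values
  are continuous functions even on merely integrable arguments and the limits for \<open>emb\<close>
  carry over.\<close>

definition markov :: "'a measure \<Rightarrow> ('a \<Rightarrow> real) \<Rightarrow> 'a \<Rightarrow> real" where
  "markov \<mu> \<phi> y = scal \<mu> y * fun_of (emb \<mu> (\<lambda>x. scal \<mu> x * \<phi> x)) y"

context
  fixes \<mu> :: "'a measure"
  assumes mu: "\<mu> \<in> prob_measures"
begin

lemma integrable_scal_mult: "integrable \<mu> \<phi> \<Longrightarrow> integrable \<mu> (\<lambda>x. scal \<mu> x * \<phi> x)"
  using integrable_mult_continuous[OF cpt mu continuous_scal[OF mu], of \<phi>] by (simp add: mult.commute)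

lemma continuous_markov: "continuous_on UNIV (markov \<mu> \<phi>)"
  unfolding markov_def by (intro continuous_intros continuous_scal[OF mu])

lemma continuous_scaled_kernel: "continuous_on UNIV (\<lambda>x. scal \<mu> x * scal \<mu> y * k x y)"
  by (intro continuous_intros continuous_scal[OF mu] k_cont_left)

lemma integrable_scaled_kernel:
  "integrable \<mu> \<phi> \<Longrightarrow> integrable \<mu> (\<lambda>x. \<phi> x * (scal \<mu> x * scal \<mu> y * k x y))"
  by (intro integrable_mult_continuous[OF cpt mu] continuous_scaled_kernel)

lemma markov_integral:
  assumes "integrable \<mu> \<phi>"
  shows "markov \<mu> \<phi> y = (\<integral>x. \<phi> x * (scal \<mu> x * scal \<mu> y * k x y) \<partial>\<mu>)"
proof -
  have "markov \<mu> \<phi> y = (\<integral>x. scal \<mu> y * (scal \<mu> x * \<phi> x * k x y) \<partial>\<mu>)"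
    unfolding markov_def fun_of_emb[OF mu integrable_scal_mult[OF assms]] by simp
  then show ?thesis by (simp add: ac_simps)
qed

lemma scaled_kernel_integral: "(\<integral>x. scal \<mu> x * scal \<mu> y * k x y \<partial>\<mu>) = 1"
  using scal_emb[OF mu, of y] fun_of_emb[OF mu integrable_scal[OF mu], of y]
  by (simp add: mult.commute[of _ "scal \<mu> y"] mult.assoc)

text \<open>Let A be the integral of \<open>scal \<mu>\<close>. The normalisation with m
  \<open>\<le>\<close> k \<open>\<le>\<close> 1 gives 1/A \<open>\<le>\<close>
  \<open>scal \<mu> y\<close> \<open>\<le>\<close> 1/(m A). Integrating the upper bound yields m A A
  \<open>\<le>\<close> 1, so two scalings multiply to at least \<open>m\<close>; the kernel
  contributes the second \<open>m\<close>.\<close>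

lemma scaled_kernel_ge: "m\<^sup>2 \<le> scal \<mu> x * scal \<mu> y * k x y"
proof -
  define A where "A = (\<integral>x. scal \<mu> x \<partial>\<mu>)"
  note int = integrable_scal[OF mu]
  have le: "1 \<le> scal \<mu> y * A" and ge: "m * scal \<mu> y * A \<le> 1" for y
  proof -
    have "(\<integral>x. scal \<mu> x * k x y \<partial>\<mu>) \<le> A"
      unfolding A_def using mult_left_mono[OF k_le less_imp_le[OF scal_pos]]
      by (intro integral_mono integrable_mult_continuous[OF cpt mu k_cont_left] int) simp
    then show "1 \<le> scal \<mu> y * A"
      using mult_left_mono[OF _ less_imp_le[OF scal_pos]] scal_emb[OF mu, of y]
        fun_of_emb[OF mu int, of y] by metis
    have "(\<integral>x. scal \<mu> x * m \<partial>\<mu>) \<le> (\<integral>x. scal \<mu> x * k x y \<partial>\<mu>)"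
      using mult_left_mono[OF k_ge less_imp_le[OF scal_pos]] int
      by (intro integral_mono integrable_mult_continuous[OF cpt mu k_cont_left] int) simp_all
    then have "A * m \<le> (\<integral>x. scal \<mu> x * k x y \<partial>\<mu>)" by (simp add: A_def)
    from mult_left_mono[OF this less_imp_le[OF scal_pos[of \<mu> y]]]
    show "m * scal \<mu> y * A \<le> 1"
      using scal_emb[OF mu, of y] fun_of_emb[OF mu int, of y] by (simp add: ac_simps)
  qed
  have "m * A * A \<le> 1"
  proof -
    have "(\<integral>y. m * A * scal \<mu> y \<partial>\<mu>) \<le> 1"
      using ge int less_imp_le[OF scal_pos] m_pos A_def
      by (intro prob_integral_bounds(2)[OF mu, where l = 0]) (auto simp: ac_simps)
    then show ?thesis by (simp add: A_def)
  qed
  have "0 < A" using le[of x] scal_pos[of \<mu> x] by (smt (verit) mult_nonneg_nonpos)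
  have "1 \<le> (scal \<mu> x * A) * (scal \<mu> y * A)" using mult_mono[OF le[of x] le[of y]] le[of x] by simp
  then have "m \<le> m * ((scal \<mu> x * A) * (scal \<mu> y * A))" using m_pos by simp
  also have "\<dots> = (m * A * A) * (scal \<mu> x * scal \<mu> y)" by (simp add: ac_simps)
  also have "\<dots> \<le> 1 * (scal \<mu> x * scal \<mu> y)"
    using \<open>m * A * A \<le> 1\<close> scal_pos by (intro mult_right_mono) (auto intro: less_imp_le)
  finally have "m * m \<le> (scal \<mu> x * scal \<mu> y) * k x y"
    using k_ge m_pos by (intro mult_mono) auto
  then show ?thesis by (simp add: power2_eq_square)
qed

lemma markov_const: "markov \<mu> (\<lambda>x. r) y = r"
  using integrable_continuous_prob[OF cpt mu continuous_on_const] scaled_kernel_integral[of y]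
  by (simp add: markov_integral)

lemma markov_diff:
  assumes "integrable \<mu> \<phi>" "integrable \<mu> \<psi>"
  shows "markov \<mu> (\<lambda>x. \<phi> x - \<psi> x) y = markov \<mu> \<phi> y - markov \<mu> \<psi> y"
  using assms integrable_scaled_kernel by (simp add: markov_integral left_diff_distrib)

lemma markov_cong_AE:
  assumes "AE x in \<mu>. \<phi> x = \<psi> x" "integrable \<mu> \<phi>" "integrable \<mu> \<psi>"
  shows "markov \<mu> \<phi> = markov \<mu> \<psi>"
proof
  fix y
  show "markov \<mu> \<phi> y = markov \<mu> \<psi> y"
    unfolding markov_integral[OF assms(2)] markov_integral[OF assms(3)]
    using assms(1) integrable_scaled_kernel[OF assms(2), of y] integrable_scaled_kernel[OF assms(3), of y]
    by (intro integral_cong_AE) auto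
qed

text \<open>Doeblin's condition \<open>k\<^sub>\<mu> \<ge> m\<^sup>2\<close> splits off the mean, which does not see oscillations.\<close>

lemma markov_contraction:
  assumes \<phi>: "continuous_on UNIV \<phi>" and D: "\<And>x y. \<phi> x - \<phi> y \<le> D"
  shows "markov \<mu> \<phi> y - markov \<mu> \<phi> y' \<le> (1 - m\<^sup>2) * D"
proof -
  note int = integrable_continuous_prob[OF cpt mu]
  interpret prob_space \<mu> using mu by (simp add: prob_measures_def)
  obtain z where z: "\<And>x. \<phi> z \<le> \<phi> x" using continuous_attains_inf[OF cpt _ \<phi>] by auto
  define q where "q y x = scal \<mu> x * scal \<mu> y * k x y - m\<^sup>2" for y x
  have q: "0 \<le> q y x" "continuous_on UNIV (q y)" "(\<integral>x. q y x \<partial>\<mu>) = 1 - m\<^sup>2" for y x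
    unfolding q_def using scaled_kernel_ge[of x y] continuous_scaled_kernel[of y]
      scaled_kernel_integral[of y] int[OF continuous_scaled_kernel[of y]]
    by (auto intro!: continuous_intros simp: prob_space)
  have eq: "markov \<mu> \<phi> y = (\<integral>x. \<phi> x * q y x \<partial>\<mu>) + m\<^sup>2 * (\<integral>x. \<phi> x \<partial>\<mu>)" for y
    unfolding q_def markov_integral[OF int[OF \<phi>]]
    using integrable_scaled_kernel[OF int[OF \<phi>], of y] int[OF \<phi>] by (simp add: right_diff_distrib)
  have iq: "integrable \<mu> (\<lambda>x. r * q y x)" "integrable \<mu> (\<lambda>x. \<phi> x * q y x)" for r y
    using \<phi> q(2) by (intro int continuous_intros; simp)+
  have "(\<integral>x. \<phi> x * q y x \<partial>\<mu>) \<le> (\<integral>x. (\<phi> z + D) * q y x \<partial>\<mu>)"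
    using D[of _ z] q(1) by (intro integral_mono iq mult_right_mono) (auto simp: algebra_simps)
  then have "(\<integral>x. \<phi> x * q y x \<partial>\<mu>) \<le> (\<phi> z + D) * (1 - m\<^sup>2)" by (simp add: q(3))
  moreover have "(\<integral>x. \<phi> z * q y' x \<partial>\<mu>) \<le> (\<integral>x. \<phi> x * q y' x \<partial>\<mu>)"
    using z q(1) by (intro integral_mono iq mult_right_mono) auto
  then have "\<phi> z * (1 - m\<^sup>2) \<le> (\<integral>x. \<phi> x * q y' x \<partial>\<mu>)" by (simp add: q(3))
  ultimately show ?thesis by (simp add: eq algebra_simps)
qed

text \<open>By symmetry the operator may be moved to the constant 1, which it fixes by
  \<open>scal_emb\<close>.\<close>

lemma markov_mean:
  assumes "integrable \<mu> \<phi>"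
  shows "(\<integral>x. markov \<mu> \<phi> x \<partial>\<mu>) = (\<integral>x. \<phi> x \<partial>\<mu>)"
proof -
  have "(\<integral>x. markov \<mu> \<phi> x \<partial>\<mu>) = (\<integral>x. \<phi> x * (scal \<mu> x * fun_of (emb \<mu> (scal \<mu>)) x) \<partial>\<mu>)"
    unfolding markov_def emb_symmetric[OF mu integrable_scal_mult[OF assms] integrable_scal[OF mu]]
    by (simp add: ac_simps)
  then show ?thesis by (simp add: scal_emb[OF mu])
qed

text \<open>The second moment of \<open>\<psi>\<close> about the value \<open>\<psi> y\<close> under
  the probability density \<open>?w\<close> is nonnegative; integrating over \<open>y\<close> and
  using invariance of the mean gives the claim.\<close>

lemma markov_form_nonneg:
  assumes \<psi>: "continuous_on UNIV \<psi>"
  shows "0 \<le> (\<integral>x. (\<psi> x - markov \<mu> \<psi> x) * \<psi> x \<partial>\<mu>)"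
proof -
  note int = integrable_continuous_prob[OF cpt mu]
  have c2: "continuous_on UNIV (\<lambda>x. (\<psi> x)\<^sup>2)" using \<psi> by (intro continuous_intros)
  have "2 * (\<psi> y * markov \<mu> \<psi> y) \<le> (\<psi> y)\<^sup>2 + markov \<mu> (\<lambda>x. (\<psi> x)\<^sup>2) y" for y
  proof -
    let ?w = "\<lambda>x. scal \<mu> x * scal \<mu> y * k x y"
    have iw: "integrable \<mu> (\<lambda>x. (\<psi> x)\<^sup>2 * ?w x)" "integrable \<mu> (\<lambda>x. 2 * \<psi> y * (\<psi> x * ?w x))"
      "integrable \<mu> (\<lambda>x. (\<psi> y)\<^sup>2 * ?w x)"
      using integrable_scaled_kernel int[OF \<psi>] int[OF c2] int[OF continuous_scaled_kernel] by simp_all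
    have "0 \<le> (\<integral>x. (\<psi> x - \<psi> y)\<^sup>2 * ?w x \<partial>\<mu>)"
      by (intro Bochner_Integration.integral_nonneg mult_nonneg_nonneg zero_le_power2
          order_trans[OF zero_le_power2 scaled_kernel_ge])
    also have "(\<lambda>x. (\<psi> x - \<psi> y)\<^sup>2 * ?w x)
        = (\<lambda>x. (\<psi> x)\<^sup>2 * ?w x - 2 * \<psi> y * (\<psi> x * ?w x) + (\<psi> y)\<^sup>2 * ?w x)"
      by (simp add: fun_eq_iff power2_diff algebra_simps)
    also have "(\<integral>x. \<dots> x \<partial>\<mu>) = markov \<mu> (\<lambda>x. (\<psi> x)\<^sup>2) y - 2 * \<psi> y * markov \<mu> \<psi> y + (\<psi> y)\<^sup>2"
      using iw by (simp add: markov_integral int[OF \<psi>] int[OF c2] scaled_kernel_integral)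
    finally show ?thesis by simp
  qed
  then have "(\<integral>y. 2 * (\<psi> y * markov \<mu> \<psi> y) \<partial>\<mu>) \<le> (\<integral>y. (\<psi> y)\<^sup>2 + markov \<mu> (\<lambda>x. (\<psi> x)\<^sup>2) y \<partial>\<mu>)"
    by (intro integral_mono int continuous_intros \<psi> continuous_markov)
  also have "\<dots> = 2 * (\<integral>y. (\<psi> y)\<^sup>2 \<partial>\<mu>)"
    using int[OF c2] int[OF continuous_markov] by (simp add: markov_mean)
  finally have "(\<integral>y. \<psi> y * markov \<mu> \<psi> y \<partial>\<mu>) \<le> (\<integral>y. (\<psi> y)\<^sup>2 \<partial>\<mu>)" by simp
  moreover have "(\<integral>x. (\<psi> x - markov \<mu> \<psi> x) * \<psi> x \<partial>\<mu>)
      = (\<integral>y. (\<psi> y)\<^sup>2 \<partial>\<mu>) - (\<integral>y. \<psi> y * markov \<mu> \<psi> y \<partial>\<mu>)"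
    using int[OF c2] int[OF continuous_on_mult[OF \<psi> continuous_markov]]
    by (simp add: algebra_simps power2_eq_square)
  ultimately show ?thesis by simp
qed

section \<open>The Poisson equation for the Markov operator\<close>

lemma markov_stability:
  assumes h: "continuous_on UNIV h" and \<delta>: "\<And>y. \<bar>h y - markov \<mu> h y\<bar> \<le> \<delta>"
  shows "h x - h y \<le> 2 / m\<^sup>2 * \<delta>"
proof -
  obtain z where z: "\<And>x. h z \<le> h x" using continuous_attains_inf[OF cpt _ h] by auto
  obtain w where w: "\<And>x. h x \<le> h w" using continuous_attains_sup[OF cpt _ h] by auto
  have "h x - h y \<le> h w - h z" for x y using z[of y] w[of x] by simp
  from markov_contraction[OF h this, of w z] \<delta>[of w] \<delta>[of z]
  have "m\<^sup>2 * (h w - h z) \<le> 2 * \<delta>" unfolding abs_le_iff by (simp add: algebra_simps)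
  then have "h w - h z \<le> 2 / m\<^sup>2 * \<delta>" using m_pos by (simp add: field_simps)
  then show ?thesis using z[of y] w[of x] by simp
qed

lemma poisson_equation:
  assumes \<phi>: "continuous_on UNIV \<phi>" and mean: "(\<integral>x. \<phi> x \<partial>\<mu>) = 0"
  shows "\<exists>\<psi>. continuous_on UNIV \<psi> \<and> (\<forall>y. \<psi> y - markov \<mu> \<psi> y = \<phi> y)"
proof -
  interpret prob_space \<mu> using mu by (simp add: prob_measures_def)
  note int = integrable_continuous_prob[OF cpt mu]
  let ?U = "\<lambda>\<psi> y. \<phi> y + markov \<mu> \<psi> y"
  have q: "0 \<le> 1 - m\<^sup>2" "1 - m\<^sup>2 < 1" using m_pos m_le_1 by (auto simp: power_le_one)
  have cont: "continuous_on UNIV (?U \<psi>)" for \<psi> by (intro continuous_intros \<phi> continuous_markov)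
  have contr: "(?U f x - ?U g x) - (?U f y - ?U g y) \<le> (1 - m\<^sup>2) * D"
    if "continuous_on UNIV f" "continuous_on UNIV g" "\<And>x y. (f x - g x) - (f y - g y) \<le> D" for f g D x y
    using markov_contraction[OF continuous_on_diff[OF that(1,2)] that(3), of x y] that(1,2)
    by (simp add: markov_diff int)
  obtain \<psi> l where \<psi>: "continuous_on UNIV \<psi>" "\<And>x. ?U \<psi> x = \<psi> x + l"
    using oscillation_contraction_fixpoint[where U = ?U, OF cpt cont q contr] by blast
  \<comment> \<open>Comparing means shows that the defect \<open>l\<close> equals the mean of
    \<open>\<phi>\<close>, which is zero.\<close>
  have "(\<integral>x. ?U \<psi> x \<partial>\<mu>) = (\<integral>x. \<psi> x \<partial>\<mu>)"
    using mean int[OF \<phi>] int[OF continuous_markov] int[OF \<psi>(1)] by (simp add: markov_mean)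
  moreover have "(\<integral>x. ?U \<psi> x \<partial>\<mu>) = (\<integral>x. \<psi> x \<partial>\<mu>) + l"
    unfolding \<psi>(2) using int[OF \<psi>(1)] by (simp add: prob_space)
  ultimately have "l = 0" by simp
  then have "\<psi> y - markov \<mu> \<psi> y = \<phi> y" for y using \<psi>(2)[of y] by simp
  then show ?thesis using \<psi>(1) by blast
qed

text \<open>This is injectivity of id - K modulo constants, for functions that are only integrable.
  Invariance of the mean forces \<open>r = 0\<close>; what remains is to pass from \<open>h\<close>
  to a continuous function.\<close>

lemma markov_harmonic_AE_const:
  assumes h: "integrable \<mu> h" and eq: "AE x in \<mu>. h x - markov \<mu> h x = r"
  shows "\<exists>s. AE x in \<mu>. h x = s"
proof -
  interpret prob_space \<mu> using mu by (simp add: prob_measures_def)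
  note int = integrable_continuous_prob[OF cpt mu]
  have iK: "integrable \<mu> (markov \<mu> \<phi>)" for \<phi> by (intro int continuous_markov)
  have "(\<integral>x. h x - markov \<mu> h x \<partial>\<mu>) = (\<integral>x. r \<partial>\<mu>)"
    using eq h iK[of h] by (intro integral_cong_AE) auto
  then have "r = 0" using h iK[of h] by (simp add: markov_mean prob_space)
  then have AE: "AE x in \<mu>. h x = markov \<mu> h x" using eq by simp
  \<comment> \<open>Applying the operator turns the almost everywhere identity into one at every
    point, so the oscillation estimate applies to the continuous function
    \<open>markov \<mu> h\<close>.\<close>
  then have "markov \<mu> h = markov \<mu> (markov \<mu> h)" by (rule markov_cong_AE) (rule h iK)+
  then have "\<bar>markov \<mu> h y - markov \<mu> (markov \<mu> h) y\<bar> \<le> 0" for y by (auto dest: fun_cong[of _ _ y])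
  from markov_stability[OF continuous_markov this]
  have "markov \<mu> h x - markov \<mu> h y \<le> 0" for x y by simp
  then have const: "markov \<mu> h x = markov \<mu> h y" for x y by (meson antisym diff_le_0_iff_le)
  fix y :: 'a
  from AE have "AE x in \<mu>. h x = markov \<mu> h y" by eventually_elim (erule trans[OF _ const])
  then show ?thesis by blast
qed

end

section \<open>Joint limits of the measure and the data\<close>

lemma uniform_limit_markov:
  assumes mu: "\<And>n. \<mu>s n \<in> prob_measures" "\<mu> \<in> prob_measures"
    and conv: "weak_star_converges \<mu>s \<mu>" and \<psi>: "continuous_on UNIV \<psi>"
  shows "uniform_limit UNIV (\<lambda>n. markov (\<mu>s n) \<psi>) (markov \<mu> \<psi>) sequentially"
  unfolding markov_def
  by (intro uniform_limit_mult_continuous[OF cpt] uniform_limit_scal uniform_limit_emb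
      uniform_limit_const continuous_intros continuous_scal mu conv \<psi>)

lemma poisson_pairing_tendsto:
  assumes mu: "\<And>n. \<mu>s n \<in> prob_measures" "\<mu> \<in> prob_measures"
    and conv: "weak_star_converges \<mu>s \<mu>"
    and \<phi>: "\<And>n. continuous_on UNIV (\<phi>s n)" "continuous_on UNIV \<phi>"
    and mean: "\<And>n. (\<integral>x. \<phi>s n x \<partial>\<mu>s n) = 0"
    and \<psi>: "\<And>n. continuous_on UNIV (\<psi>s n)" "continuous_on UNIV \<psi>"
    and sols: "\<And>n y. \<psi>s n y - markov (\<mu>s n) (\<psi>s n) y = \<phi>s n y"
    and sol: "\<And>y. \<psi> y - markov \<mu> \<psi> y = \<phi> y"
    and lim: "uniform_limit UNIV \<phi>s \<phi> sequentially"
  shows "(\<lambda>n. \<integral>x. \<phi>s n x * \<psi>s n x \<partial>\<mu>s n) \<longlonglongrightarrow> (\<integral>x. \<phi> x * \<psi> x \<partial>\<mu>)"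
proof -
  note int = integrable_continuous_prob[OF cpt mu(1)]
  fix x0 :: 'a
  \<comment> \<open>Solutions are determined only up to constants, so \<open>\<psi>s n\<close>
    itself need not converge; it is shifted to agree with \<open>\<psi>\<close> at
    \<open>x0\<close>.\<close>
  define \<xi> where "\<xi> n x = \<psi>s n x - (\<psi>s n x0 - \<psi> x0)" for n x
  have \<xi>: "continuous_on UNIV (\<xi> n)" for n unfolding \<xi>_def by (intro continuous_intros \<psi>)
  \<comment> \<open>The residual of \<open>\<psi>\<close> in the equation for
    \<open>\<mu>s n\<close> tends to zero once \<open>\<psi>\<close> is recognised as the limit of
    this expression.\<close>
  have "uniform_limit UNIV (\<lambda>n y. \<phi>s n y + markov (\<mu>s n) \<psi> y) (\<lambda>y. \<phi> y + markov \<mu> \<psi> y) sequentially"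
    by (intro uniform_limit_add lim uniform_limit_markov mu conv \<psi>)
  then have e: "uniform_limit UNIV (\<lambda>n y. \<phi>s n y + markov (\<mu>s n) \<psi> y) \<psi> sequentially"
    by (simp flip: sol)
  have "uniform_limit UNIV \<xi> \<psi> sequentially"
  proof (rule uniform_limitI)
    fix e :: real assume e: "e > 0"
    define \<delta> where "\<delta> = e * m\<^sup>2 / 4"
    have \<delta>: "0 < \<delta>" "2 / m\<^sup>2 * \<delta> < e" using e m_pos by (auto simp: \<delta>_def)
    from uniform_limitD[OF \<open>uniform_limit UNIV _ \<psi> sequentially\<close> \<delta>(1)]
    show "\<forall>\<^sub>F n in sequentially. \<forall>x\<in>UNIV. dist (\<xi> n x) (\<psi> x) < e"
    proof eventually_elim
      case (elim n)
      define h where "h x = \<psi>s n x - \<psi> x" for x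
      have h: "continuous_on UNIV h" unfolding h_def by (intro continuous_intros \<psi>)
      have "\<bar>h y - markov (\<mu>s n) h y\<bar> \<le> \<delta>" for y
        using elim[rule_format, OF UNIV_I, of y] sols[of n y]
        unfolding h_def markov_diff[OF mu(1) int[OF \<psi>(1)] int[OF \<psi>(2)]] dist_real_def
        by linarith
      from markov_stability[OF mu(1) h this]
      have "h x - h y < e" for x y using \<delta>(2) order_le_less_trans by blast
      from this[of _ x0] this[of x0] show ?case
        by (auto simp: dist_real_def \<xi>_def h_def abs_less_iff algebra_simps)
    qed
  qed
  with \<phi> \<psi>(2) \<xi> lim have "(\<lambda>n. \<integral>x. \<phi>s n x * \<xi> n x \<partial>\<mu>s n) \<longlonglongrightarrow> (\<integral>x. \<phi> x * \<psi> x \<partial>\<mu>)"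
    by (intro weak_star_converges_uniform[OF cpt mu(1) conv] uniform_limit_mult_continuous[OF cpt]
        continuous_on_mult)
  \<comment> \<open>The shift is invisible here because \<open>\<phi>s n\<close> has zero
    mean.\<close>
  moreover have "(\<integral>x. \<phi>s n x * \<xi> n x \<partial>\<mu>s n) = (\<integral>x. \<phi>s n x * \<psi>s n x \<partial>\<mu>s n)" for n
    using int[OF continuous_on_mult[OF \<phi>(1) \<psi>(1)]] int[OF \<phi>(1)] mean[of n]
    by (simp add: \<xi>_def right_diff_distrib)
  ultimately show ?thesis by simp
qed

end

section \<open>The metric tensor\<close>

lemma equiv_eq_mod_const: "equiv (L2_functions \<mu>) (eq_mod_const \<mu>)"
proof (rule equivI)
  show "eq_mod_const \<mu> \<subseteq> L2_functions \<mu> \<times> L2_functions \<mu>" by (auto simp: eq_mod_const_def)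
  show "refl_on (L2_functions \<mu>) (eq_mod_const \<mu>)" by (auto simp: refl_on_def eq_mod_const_def)
  show "sym (eq_mod_const \<mu>)"
  proof (rule symI)
    fix \<phi> \<psi> assume "(\<phi>, \<psi>) \<in> eq_mod_const \<mu>"
    then obtain r where L2: "\<phi> \<in> L2_functions \<mu>" "\<psi> \<in> L2_functions \<mu>"
      and "AE x in \<mu>. \<phi> x - \<psi> x = r" by (auto simp: eq_mod_const_def)
    from this(3) have "AE x in \<mu>. \<psi> x - \<phi> x = - r" by eventually_elim simp
    then show "(\<psi>, \<phi>) \<in> eq_mod_const \<mu>" using L2 by (auto simp: eq_mod_const_def)
  qed
  show "trans (eq_mod_const \<mu>)"
  proof (rule transI)
    fix \<phi> \<psi> \<xi> assume "(\<phi>, \<psi>) \<in> eq_mod_const \<mu>" "(\<psi>, \<xi>) \<in> eq_mod_const \<mu>"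
    then obtain r s where L2: "\<phi> \<in> L2_functions \<mu>" "\<xi> \<in> L2_functions \<mu>"
      and "AE x in \<mu>. \<phi> x - \<psi> x = r" "AE x in \<mu>. \<psi> x - \<xi> x = s" by (auto simp: eq_mod_const_def)
    from this(3,4) have "AE x in \<mu>. \<phi> x - \<xi> x = r + s" by eventually_elim simp
    then show "(\<phi>, \<xi>) \<in> eq_mod_const \<mu>" using L2 by (auto simp: eq_mod_const_def)
  qed
qed

lemma L2_functions_integrable:
  assumes "\<mu> \<in> prob_measures" "\<phi> \<in> L2_functions \<mu>"
  shows "integrable \<mu> \<phi>"
proof -
  interpret prob_space \<mu> using assms by (simp add: prob_measures_def)
  show ?thesis using assms(2) square_integrable_imp_integrable by (auto simp: L2_functions_def)
qed

lemma L2_functions_continuous: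
  fixes \<phi> :: "'a::metric_space \<Rightarrow> real"
  assumes "compact (UNIV :: 'a set)" "\<mu> \<in> prob_measures" "continuous_on UNIV \<phi>"
  shows "\<phi> \<in> L2_functions \<mu>"
  using integrable_continuous_prob[OF assms(1,2) continuous_on_power[OF assms(3)]]
    borel_measurable_prob_measures[OF assms(2,3)] by (simp add: L2_functions_def)

lemma L2_functions_diff_continuous:
  fixes \<phi> :: "'a::metric_space \<Rightarrow> real"
  assumes "compact (UNIV :: 'a set)" "\<mu> \<in> prob_measures" "\<phi> \<in> L2_functions \<mu>" "continuous_on UNIV g"
  shows "(\<lambda>x. \<phi> x - g x) \<in> L2_functions \<mu>"
proof -
  have "integrable \<mu> (\<lambda>x. (\<phi> x)\<^sup>2 - 2 * (\<phi> x * g x) + (g x)\<^sup>2)"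
    using assms(3) L2_functions_continuous[OF assms(1,2,4)]
      integrable_mult_continuous[OF assms(1,2,4) L2_functions_integrable[OF assms(2,3)]]
    by (simp add: L2_functions_def)
  then have "integrable \<mu> (\<lambda>x. (\<phi> x - g x)\<^sup>2)" by (simp add: power2_diff algebra_simps)
  then show ?thesis
    using assms(3) borel_measurable_prob_measures[OF assms(2,4)] by (auto simp: L2_functions_def)
qed

text \<open>Changing the representative by a constant \<open>r\<close> changes the integral by
  \<open>r\<close> times the mean of \<open>\<phi>\<close>, hence not at all; the class contains
  \<open>\<psi>\<close>, so the described value is unique.\<close>

lemma L2_pairing_class:
  assumes mean: "(\<integral>x. \<phi> x \<partial>\<mu>) = 0" and int: "integrable \<mu> \<phi>" "integrable \<mu> (\<lambda>x. \<phi> x * \<psi> x)"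
    and L2: "\<psi> \<in> L2_functions \<mu>"
  shows "L2_pairing \<mu> \<phi> (eq_mod_const \<mu> `` {\<psi>}) = (\<integral>x. \<phi> x * \<psi> x \<partial>\<mu>)"
  unfolding L2_pairing_def
proof (rule the_equality)
  show "\<forall>\<psi>'\<in>eq_mod_const \<mu> `` {\<psi>}. (\<integral>x. \<phi> x * \<psi>' x \<partial>\<mu>) = (\<integral>x. \<phi> x * \<psi> x \<partial>\<mu>)"
  proof
    fix \<psi>' assume "\<psi>' \<in> eq_mod_const \<mu> `` {\<psi>}"
    then obtain r where L2': "\<psi>' \<in> L2_functions \<mu>" and r: "AE x in \<mu>. \<psi> x - \<psi>' x = r"
      by (auto simp: eq_mod_const_def)
    have [measurable]: "\<phi> \<in> borel_measurable \<mu>" "\<psi> \<in> borel_measurable \<mu>" "\<psi>' \<in> borel_measurable \<mu>"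
      using L2 L2' int by (auto simp: L2_functions_def)
    have "AE x in \<mu>. \<phi> x * \<psi>' x = \<phi> x * \<psi> x - r * \<phi> x"
      using r by eventually_elim (auto simp: algebra_simps)
    then have "(\<integral>x. \<phi> x * \<psi>' x \<partial>\<mu>) = (\<integral>x. \<phi> x * \<psi> x - r * \<phi> x \<partial>\<mu>)"
      by (intro integral_cong_AE) auto
    also have "\<dots> = (\<integral>x. \<phi> x * \<psi> x \<partial>\<mu>)" using int mean by simp
    finally show "(\<integral>x. \<phi> x * \<psi>' x \<partial>\<mu>) = (\<integral>x. \<phi> x * \<psi> x \<partial>\<mu>)" .
  qed
  have "\<psi> \<in> eq_mod_const \<mu> `` {\<psi>}" using L2 by (auto simp: eq_mod_const_def)
  then show "v = (\<integral>x. \<phi> x * \<psi> x \<partial>\<mu>)"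
    if "\<forall>\<psi>'\<in>eq_mod_const \<mu> `` {\<psi>}. (\<integral>x. \<phi> x * \<psi>' x \<partial>\<mu>) = v" for v
    using bspec[OF that] by simp
qed

section \<open>Identification of the defined objects\<close>

locale entropic_rkhs = compact_rkhs "kernel_c \<epsilon> c" fun_of m
  for \<epsilon> :: real and c :: "'a::metric_space \<Rightarrow> 'a \<Rightarrow> real"
    and fun_of :: "'h::{real_inner, banach} \<Rightarrow> 'a \<Rightarrow> real" and m :: real +
  assumes eps_pos: "0 < \<epsilon>"
begin

text \<open>Division by \<open>\<epsilon>\<close> turns the defining integral equation at
  \<open>y\<close> into the Sinkhorn equation at \<open>y\<close>; existence and uniqueness of its
  continuous solution make the definite description meaningful.\<close>

lemma self_potential_eq:
  assumes mu: "\<mu> \<in> prob_measures"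
  shows "self_potential \<epsilon> c \<mu> = (\<lambda>x. \<epsilon> * potential \<mu> x)"
proof -
  have eq: "(\<integral>x. exp (1 / \<epsilon> * (f x + f y - c x y)) \<partial>\<mu>) = 1
      \<longleftrightarrow> sinkhorn \<mu> (\<lambda>x. f x / \<epsilon>) y = f y / \<epsilon>" if f: "continuous_on UNIV f" for f y
  proof -
    have f': "continuous_on UNIV (\<lambda>x. f x / \<epsilon>)" using f eps_pos by (intro continuous_intros) auto
    define Z where "Z = fun_of (emb \<mu> (\<lambda>x. exp (f x / \<epsilon>))) y"
    have Z: "0 < Z" unfolding Z_def by (rule exp_emb_pos[OF mu f'])
    have "exp (1 / \<epsilon> * (f x + f y - c x y)) = exp (f y / \<epsilon>) * (exp (f x / \<epsilon>) * kernel_c \<epsilon> c x y)" for x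
      unfolding kernel_c_def mult_exp_exp by (simp add: add_divide_distrib diff_divide_distrib)
    then have "(\<integral>x. exp (1 / \<epsilon> * (f x + f y - c x y)) \<partial>\<mu>) = exp (f y / \<epsilon>) * Z"
      by (simp add: Z_def fun_of_emb[OF mu exp_integrable[OF mu f']])
    also have "\<dots> = exp (f y / \<epsilon> + ln Z)" using Z by (simp add: exp_add)
    also have "\<dots> = 1 \<longleftrightarrow> - ln Z = f y / \<epsilon>" by auto
    finally show ?thesis by (simp add: sinkhorn_def Z_def)
  qed
  show ?thesis unfolding self_potential_def
  proof (rule the_equality)
    have "continuous_on UNIV (\<lambda>x. \<epsilon> * potential \<mu> x)"
      by (intro continuous_intros potential mu)
    then show "continuous_on UNIV (\<lambda>x. \<epsilon> * potential \<mu> x) \<and>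
        (\<forall>y. (\<integral>x. exp (1 / \<epsilon> * (\<epsilon> * potential \<mu> x + \<epsilon> * potential \<mu> y - c x y)) \<partial>\<mu>) = 1)"
      using eq[of "\<lambda>x. \<epsilon> * potential \<mu> x"] eps_pos potential(2)[OF mu] by simp
  next
    fix f assume f: "continuous_on UNIV f \<and> (\<forall>y. (\<integral>x. exp (1 / \<epsilon> * (f x + f y - c x y)) \<partial>\<mu>) = 1)"
    then have "sinkhorn \<mu> (\<lambda>x. f x / \<epsilon>) = (\<lambda>x. f x / \<epsilon>)" using eq[of f] by auto
    moreover have "continuous_on UNIV (\<lambda>x. f x / \<epsilon>)"
      using f eps_pos by (intro continuous_intros) auto
    ultimately have "(\<lambda>x. f x / \<epsilon>) = potential \<mu>" using potential_unique[OF mu] by blast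
    then have "\<epsilon> * potential \<mu> x = f x" for x
      using fun_cong[of _ "potential \<mu>" x] eps_pos by (metis nonzero_mult_div_cancel_left times_divide_eq_right less_irrefl)
    then show "f = (\<lambda>x. \<epsilon> * potential \<mu> x)" by auto
  qed
qed

lemma a_fun_eq: "\<mu> \<in> prob_measures \<Longrightarrow> a_fun \<epsilon> c \<mu> = scal \<mu>"
  using eps_pos by (simp add: fun_eq_iff a_fun_def scal_def self_potential_eq)

lemma K_op_eq: "\<mu> \<in> prob_measures \<Longrightarrow> integrable \<mu> \<phi> \<Longrightarrow> K_op \<epsilon> c \<mu> \<phi> = markov \<mu> \<phi>"
  by (simp add: fun_eq_iff K_op_def kernel_mu_def a_fun_eq markov_integral)

lemma B_map_eq:
  assumes mu: "\<mu> \<in> prob_measures"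
  shows "B_map \<epsilon> c fun_of \<mu> = emb \<mu> (scal \<mu>)"
  unfolding B_map_def a_fun_eq[OF mu]
  by (rule the_equality) (auto simp: fun_eq_iff fun_of_emb[OF mu integrable_scal[OF mu]] intro!: fun_of_eqD)

text \<open>If representatives differ by \<open>r\<close> almost everywhere, their images under K
  differ by \<open>r\<close> everywhere, so the differences cancel and the union collapses to a
  single class.\<close>

lemma id_minus_K_class:
  assumes mu: "\<mu> \<in> prob_measures" and \<psi>: "\<psi> \<in> L2_functions \<mu>"
  shows "id_minus_K \<epsilon> c \<mu> (eq_mod_const \<mu> `` {\<psi>})
    = eq_mod_const \<mu> `` {\<lambda>y. \<psi> y - markov \<mu> \<psi> y}"
proof -
  let ?N = "\<lambda>\<phi> y. \<phi> y - K_op \<epsilon> c \<mu> \<phi> y"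
  note int = L2_functions_integrable[OF mu]
  have L2: "?N \<phi> \<in> L2_functions \<mu>" if "\<phi> \<in> L2_functions \<mu>" for \<phi>
    unfolding K_op_eq[OF mu int[OF that]]
    by (rule L2_functions_diff_continuous[OF cpt mu that continuous_markov[OF mu]])
  have "(\<lambda>\<phi>. eq_mod_const \<mu> `` {?N \<phi>}) respects eq_mod_const \<mu>"
  proof (rule congruentI)
    fix \<phi> \<xi> assume "(\<phi>, \<xi>) \<in> eq_mod_const \<mu>"
    then obtain r where r: "AE x in \<mu>. \<phi> x - \<xi> x = r"
      and L: "\<phi> \<in> L2_functions \<mu>" "\<xi> \<in> L2_functions \<mu>" by (auto simp: eq_mod_const_def)
    have "markov \<mu> \<phi> y - markov \<mu> \<xi> y = r" for y
    proof -
      have "markov \<mu> (\<lambda>x. \<phi> x - \<xi> x) = markov \<mu> (\<lambda>x. r)"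
        using r int[OF L(1)] int[OF L(2)] integrable_continuous_prob[OF cpt mu continuous_on_const]
        by (intro markov_cong_AE[OF mu]) auto
      then show ?thesis using markov_diff[OF mu int[OF L(1)] int[OF L(2)]] markov_const[OF mu] by metis
    qed
    then have "AE x in \<mu>. ?N \<phi> x - ?N \<xi> x = 0"
      using r unfolding K_op_eq[OF mu int[OF L(1)]] K_op_eq[OF mu int[OF L(2)]]
      by (auto elim!: eventually_mono simp: algebra_simps)
    then have "(?N \<phi>, ?N \<xi>) \<in> eq_mod_const \<mu>" using L2 L unfolding eq_mod_const_def by blast
    then show "eq_mod_const \<mu> `` {?N \<phi>} = eq_mod_const \<mu> `` {?N \<xi>}"
      by (rule equiv_class_eq[OF equiv_eq_mod_const])
  qed
  from UN_equiv_class[OF equiv_eq_mod_const this \<psi>] show ?thesis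
    unfolding id_minus_K_def K_op_eq[OF mu int[OF \<psi>]] .
qed

lemma inj_on_id_minus_K:
  assumes mu: "\<mu> \<in> prob_measures"
  shows "inj_on (id_minus_K \<epsilon> c \<mu>) (L2_mod_const \<mu>)"
proof (rule inj_onI)
  note int = L2_functions_integrable[OF mu]
  fix P Q assume P: "P \<in> L2_mod_const \<mu>" and Q: "Q \<in> L2_mod_const \<mu>"
    and eq: "id_minus_K \<epsilon> c \<mu> P = id_minus_K \<epsilon> c \<mu> Q"
  from P obtain \<phi> where \<phi>: "P = eq_mod_const \<mu> `` {\<phi>}" "\<phi> \<in> L2_functions \<mu>"
    unfolding L2_mod_const_def by (rule quotientE)
  from Q obtain \<psi> where \<psi>: "Q = eq_mod_const \<mu> `` {\<psi>}" "\<psi> \<in> L2_functions \<mu>"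
    unfolding L2_mod_const_def by (rule quotientE)
  have L2: "(\<lambda>y. f y - markov \<mu> f y) \<in> L2_functions \<mu>" if "f \<in> L2_functions \<mu>" for f
    by (rule L2_functions_diff_continuous[OF cpt mu that continuous_markov[OF mu]])
  have "(\<lambda>y. \<phi> y - markov \<mu> \<phi> y, \<lambda>y. \<psi> y - markov \<mu> \<psi> y) \<in> eq_mod_const \<mu>"
    using eq unfolding \<phi>(1) \<psi>(1) id_minus_K_class[OF mu \<phi>(2)] id_minus_K_class[OF mu \<psi>(2)]
    by (simp add: eq_equiv_class_iff[OF equiv_eq_mod_const L2 L2] \<phi>(2) \<psi>(2))
  then obtain r where "AE x in \<mu>. \<phi> x - markov \<mu> \<phi> x - (\<psi> x - markov \<mu> \<psi> x) = r"
    by (auto simp: eq_mod_const_def)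
  then have "AE x in \<mu>. (\<phi> x - \<psi> x) - markov \<mu> (\<lambda>x. \<phi> x - \<psi> x) x = r"
    unfolding markov_diff[OF mu int[OF \<phi>(2)] int[OF \<psi>(2)]] by eventually_elim simp
  then have "\<exists>s. AE x in \<mu>. \<phi> x - \<psi> x = s"
    using int[OF \<phi>(2)] int[OF \<psi>(2)] by (intro markov_harmonic_AE_const[OF mu]) auto
  then have "(\<phi>, \<psi>) \<in> eq_mod_const \<mu>" using \<phi>(2) \<psi>(2) by (simp add: eq_mod_const_def)
  then show "P = Q" unfolding \<phi>(1) \<psi>(1) by (rule equiv_class_eq[OF equiv_eq_mod_const])
qed

section \<open>The correction term and the two semicontinuity statements\<close>

definition velocity :: "'a measure \<Rightarrow> 'h \<Rightarrow> 'a \<Rightarrow> real" where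
  "velocity \<mu> \<beta> x = scal \<mu> x * fun_of \<beta> x"

text \<open>For a tangent pair the velocity has zero mean and a solution exists. The choice leaves
  an additive constant open, which \<open>correction\<close> does not see.\<close>

definition corrector :: "'a measure \<Rightarrow> 'h \<Rightarrow> 'a \<Rightarrow> real" where
  "corrector \<mu> \<beta> = (SOME \<psi>. continuous_on UNIV \<psi> \<and> (\<forall>y. \<psi> y - markov \<mu> \<psi> y = velocity \<mu> \<beta> y))"

definition correction :: "'a measure \<Rightarrow> 'h \<Rightarrow> real" where
  "correction \<mu> \<beta> = (\<integral>x. velocity \<mu> \<beta> x * corrector \<mu> \<beta> x \<partial>\<mu>)"

context
  fixes \<mu> :: "'a measure" and \<beta> :: 'h
  assumes tangent: "(\<mu>, \<beta>) \<in> tangent_pairs \<epsilon> c fun_of"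
begin

lemma tangent_prob: "\<mu> \<in> prob_measures"
  using tangent by (simp add: tangent_pairs_def)

lemma continuous_velocity: "continuous_on UNIV (velocity \<mu> \<beta>)"
  unfolding velocity_def[abs_def] by (intro continuous_intros continuous_scal[OF tangent_prob])

lemma velocity_mean: "(\<integral>x. velocity \<mu> \<beta> x \<partial>\<mu>) = 0"
  using tangent inner_emb[OF tangent_prob integrable_scal[OF tangent_prob], of \<beta>]
  by (simp add: tangent_pairs_def B_map_eq[OF tangent_prob] velocity_def)

lemma corrector:
  "continuous_on UNIV (corrector \<mu> \<beta>)"
  "corrector \<mu> \<beta> y - markov \<mu> (corrector \<mu> \<beta>) y = velocity \<mu> \<beta> y"
  using someI_ex[OF poisson_equation[OF tangent_prob continuous_velocity velocity_mean]]
  unfolding corrector_def by auto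

lemma correction_nonneg: "0 \<le> correction \<mu> \<beta>"
  using markov_form_nonneg[OF tangent_prob corrector(1)] by (simp add: correction_def corrector(2))

text \<open>The class of the corrector is mapped by id - K to the class of the velocity, so by
  injectivity it is the value of the inverse there.\<close>

lemma metric_tensor_eq:
  "metric_tensor \<epsilon> c fun_of \<mu> \<beta> = \<epsilon> / 2 * ((norm \<beta>)\<^sup>2 + 2 * correction \<mu> \<beta>)"
proof -
  note mu = tangent_prob
  let ?\<psi> = "corrector \<mu> \<beta>"
  have L2: "?\<psi> \<in> L2_functions \<mu>" by (rule L2_functions_continuous[OF cpt mu corrector(1)])
  have "id_minus_K_inv \<epsilon> c \<mu> (eq_mod_const \<mu> `` {velocity \<mu> \<beta>}) = eq_mod_const \<mu> `` {?\<psi>}"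
  proof -
    have "id_minus_K \<epsilon> c \<mu> (eq_mod_const \<mu> `` {?\<psi>}) = eq_mod_const \<mu> `` {velocity \<mu> \<beta>}"
      unfolding id_minus_K_class[OF mu L2] corrector(2) ..
    moreover have "eq_mod_const \<mu> `` {?\<psi>} \<in> L2_mod_const \<mu>"
      unfolding L2_mod_const_def by (rule quotientI[OF L2])
    ultimately show ?thesis
      unfolding id_minus_K_inv_def using the_inv_into_f_f[OF inj_on_id_minus_K[OF mu]] by metis
  qed
  moreover have "L2_pairing \<mu> (velocity \<mu> \<beta>) (eq_mod_const \<mu> `` {?\<psi>}) = correction \<mu> \<beta>"
    unfolding correction_def
    by (intro L2_pairing_class velocity_mean L2 integrable_continuous_prob[OF cpt mu]
        continuous_velocity continuous_on_mult corrector(1))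
  ultimately show ?thesis
    by (simp add: metric_tensor_def a_fun_eq[OF mu] flip: velocity_def)
qed

end

text \<open>Bounded norms and pointwise convergence are the common consequence of norm convergence
  and of weak convergence along a norm-bounded subsequence, so one lemma serves both claims.\<close>

lemma correction_tendsto:
  assumes tangent: "\<And>n. (\<mu>s n, \<beta>s n) \<in> tangent_pairs \<epsilon> c fun_of" "(\<mu>, \<beta>) \<in> tangent_pairs \<epsilon> c fun_of"
    and conv: "weak_star_converges \<mu>s \<mu>"
    and bdd: "\<forall>\<^sub>F n in sequentially. norm (\<beta>s n) \<le> C"
    and lim: "\<And>x. (\<lambda>n. fun_of (\<beta>s n) x) \<longlonglongrightarrow> fun_of \<beta> x"
  shows "(\<lambda>n. correction (\<mu>s n) (\<beta>s n)) \<longlonglongrightarrow> correction \<mu> \<beta>"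
proof -
  note mu = tangent_prob[OF tangent(1)] tangent_prob[OF tangent(2)]
  have "uniform_limit UNIV (\<lambda>n. velocity (\<mu>s n) (\<beta>s n)) (velocity \<mu> \<beta>) sequentially"
    unfolding velocity_def[abs_def]
    by (intro uniform_limit_mult_continuous[OF cpt] uniform_limit_scal continuous_scal
        continuous_fun_of uniform_limit_fun_of[OF bdd lim] mu conv)
  then show ?thesis
    unfolding correction_def
    by (intro poisson_pairing_tendsto[OF mu conv] continuous_velocity velocity_mean corrector tangent)
qed

lemma metric_tensor_continuous:
  assumes tangent: "\<And>n. (\<mu>s n, \<beta>s n) \<in> tangent_pairs \<epsilon> c fun_of" "(\<mu>, \<beta>) \<in> tangent_pairs \<epsilon> c fun_of"
    and conv: "weak_star_converges \<mu>s \<mu>" and lim: "\<beta>s \<longlonglongrightarrow> \<beta>"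
  shows "(\<lambda>n. metric_tensor \<epsilon> c fun_of (\<mu>s n) (\<beta>s n)) \<longlonglongrightarrow> metric_tensor \<epsilon> c fun_of \<mu> \<beta>"
proof -
  have "\<forall>\<^sub>F n in sequentially. norm (\<beta>s n) < norm \<beta> + 1"
    using order_tendstoD(2)[OF tendsto_norm[OF lim]] by simp
  then have "\<forall>\<^sub>F n in sequentially. norm (\<beta>s n) \<le> norm \<beta> + 1" by eventually_elim simp
  moreover have "(\<lambda>n. fun_of (\<beta>s n) x) \<longlonglongrightarrow> fun_of \<beta> x" for x
    using tendsto_inner[OF lim tendsto_const[of "sect x"]] by (simp add: sect)
  ultimately have "(\<lambda>n. correction (\<mu>s n) (\<beta>s n)) \<longlonglongrightarrow> correction \<mu> \<beta>"
    by (rule correction_tendsto[OF tangent conv])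
  then show ?thesis
    unfolding metric_tensor_eq[OF tangent(1)] metric_tensor_eq[OF tangent(2)]
    by (intro tendsto_intros lim)
qed

lemma metric_tensor_lsc:
  assumes tangent: "\<And>n. (\<mu>s n, \<beta>s n) \<in> tangent_pairs \<epsilon> c fun_of" "(\<mu>, \<beta>) \<in> tangent_pairs \<epsilon> c fun_of"
    and conv: "weak_star_converges \<mu>s \<mu>" and lim: "weakly_converges \<beta>s \<beta>"
  shows "ereal (metric_tensor \<epsilon> c fun_of \<mu> \<beta>)
    \<le> liminf (\<lambda>n. ereal (metric_tensor \<epsilon> c fun_of (\<mu>s n) (\<beta>s n)))"
proof -
  let ?g = "\<lambda>n. metric_tensor \<epsilon> c fun_of (\<mu>s n) (\<beta>s n)"
  have inner: "(\<lambda>n. \<beta>s n \<bullet> v) \<longlonglongrightarrow> \<beta> \<bullet> v" for v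
    using lim bounded_linear_inner_left unfolding weakly_converges_def by blast
  have ev: "\<forall>\<^sub>F n in sequentially. C < ?g n" if C: "C < metric_tensor \<epsilon> c fun_of \<mu> \<beta>" for C
  proof (rule ccontr)
    assume "\<not> (\<forall>\<^sub>F n in sequentially. C < ?g n)"
    then have "\<forall>k. \<exists>n\<ge>k. ?g n \<le> C" by (simp add: eventually_sequentially not_less)
    then have "infinite {n. ?g n \<le> C}" by (simp add: infinite_nat_iff_unbounded_le)
    from infinite_enumerate[OF this] obtain r :: "nat \<Rightarrow> nat"
      where "strict_mono r \<and> (\<forall>n. r n \<in> {n. ?g n \<le> C})" ..
    then have r: "strict_mono r" "?g (r n) \<le> C" for n by simp_all
    have bdd: "(norm (\<beta>s (r n)))\<^sup>2 \<le> 2 * C / \<epsilon>" for n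
    proof -
      have "\<epsilon> / 2 * (norm (\<beta>s (r n)))\<^sup>2 \<le> ?g (r n)"
        unfolding metric_tensor_eq[OF tangent(1)]
        using eps_pos correction_nonneg[OF tangent(1)] by (intro mult_left_mono) auto
      then have "\<epsilon> / 2 * (norm (\<beta>s (r n)))\<^sup>2 \<le> C" using r(2)[of n] by linarith
      then show ?thesis using eps_pos by (simp add: field_simps)
    qed
    have "(\<lambda>n. correction (\<mu>s (r n)) (\<beta>s (r n))) \<longlonglongrightarrow> correction \<mu> \<beta>"
    proof (rule correction_tendsto)
      show "(\<mu>s (r n), \<beta>s (r n)) \<in> tangent_pairs \<epsilon> c fun_of" for n by (rule tangent)
      show "(\<mu>, \<beta>) \<in> tangent_pairs \<epsilon> c fun_of" by (rule tangent)
      show "weak_star_converges (\<lambda>n. \<mu>s (r n)) \<mu>"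
        using conv LIMSEQ_subseq_LIMSEQ[OF _ r(1)] unfolding weak_star_converges_def
        by (fastforce simp: o_def)
      show "\<forall>\<^sub>F n in sequentially. norm (\<beta>s (r n)) \<le> sqrt (2 * C / \<epsilon>)"
        using bdd by (simp add: real_le_rsqrt)
      show "(\<lambda>n. fun_of (\<beta>s (r n)) x) \<longlonglongrightarrow> fun_of \<beta> x" for x
        using LIMSEQ_subseq_LIMSEQ[OF inner[of "sect x"] r(1)] by (simp add: o_def sect)
    qed
    \<comment> \<open>The squared norm of \<open>\<beta>s (r n)\<close> is replaced by its affine
      minorant touching at \<open>\<beta>\<close>, which converges under weak convergence and has
      the squared norm of \<open>\<beta>\<close> as its limit.\<close>
    then have "(\<lambda>n. \<epsilon> / 2 * ((2 * (\<beta>s (r n) \<bullet> \<beta>) - \<beta> \<bullet> \<beta>) + 2 * correction (\<mu>s (r n)) (\<beta>s (r n))))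
        \<longlonglongrightarrow> \<epsilon> / 2 * ((2 * (\<beta> \<bullet> \<beta>) - \<beta> \<bullet> \<beta>) + 2 * correction \<mu> \<beta>)"
      using LIMSEQ_subseq_LIMSEQ[OF inner[of \<beta>] r(1), unfolded o_def]
      by (intro tendsto_mult tendsto_add tendsto_diff tendsto_const)
    moreover have "\<epsilon> / 2 * ((2 * (\<beta>s (r n) \<bullet> \<beta>) - \<beta> \<bullet> \<beta>) + 2 * correction (\<mu>s (r n)) (\<beta>s (r n))) \<le> C" for n
    proof -
      have "2 * (\<beta>s (r n) \<bullet> \<beta>) - \<beta> \<bullet> \<beta> \<le> (norm (\<beta>s (r n)))\<^sup>2"
        using zero_le_power2[of "norm (\<beta>s (r n) - \<beta>)"]
        by (simp add: power2_norm_eq_inner inner_diff inner_commute)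
      then have "\<epsilon> / 2 * ((2 * (\<beta>s (r n) \<bullet> \<beta>) - \<beta> \<bullet> \<beta>) + 2 * correction (\<mu>s (r n)) (\<beta>s (r n))) \<le> ?g (r n)"
        unfolding metric_tensor_eq[OF tangent(1)] using eps_pos by (intro mult_left_mono) auto
      then show ?thesis using r(2)[of n] by linarith
    qed
    ultimately have "\<epsilon> / 2 * ((2 * (\<beta> \<bullet> \<beta>) - \<beta> \<bullet> \<beta>) + 2 * correction \<mu> \<beta>) \<le> C"
      using LIMSEQ_le_const2 by blast
    then show False using C unfolding metric_tensor_eq[OF tangent(2)] by (simp add: power2_norm_eq_inner)
  qed
  show ?thesis unfolding le_Liminf_iff
  proof (intro allI impI)
    fix y assume y: "y < ereal (metric_tensor \<epsilon> c fun_of \<mu> \<beta>)"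
    show "\<forall>\<^sub>F n in sequentially. y < ereal (?g n)" using y ev by (cases y) auto
  qed
qed

end

theorem proposition4p14:
  fixes c :: "'a::metric_space \<Rightarrow> 'a \<Rightarrow> real"
    and \<epsilon> :: real
    and fun_of :: "'h::{real_inner, banach} \<Rightarrow> 'a \<Rightarrow> real"
  assumes "compact (UNIV :: 'a set)"
    and "\<epsilon> > 0"
    and "continuous_on UNIV (\<lambda>(x, y). c x y)"
    and "\<And>x y. c x y \<ge> 0"
    and "\<And>x y. c x y = c y x"
    and "positive_definite_kernel (kernel_c \<epsilon> c)"
    and "is_rkhs (kernel_c \<epsilon> c) fun_of"
    and "universal_rkhs fun_of"
  shows "(\<forall>\<mu>s \<mu> \<beta>s \<beta>.
            (\<forall>n. (\<mu>s n, \<beta>s n) \<in> tangent_pairs \<epsilon> c fun_of) \<longrightarrow>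
            (\<mu>, \<beta>) \<in> tangent_pairs \<epsilon> c fun_of \<longrightarrow>
            weak_star_converges \<mu>s \<mu> \<longrightarrow> \<beta>s \<longlonglongrightarrow> \<beta> \<longrightarrow>
            (\<lambda>n. metric_tensor \<epsilon> c fun_of (\<mu>s n) (\<beta>s n)) \<longlonglongrightarrow> metric_tensor \<epsilon> c fun_of \<mu> \<beta>)
       \<and> (\<forall>\<mu>s \<mu> \<beta>s \<beta>.
            (\<forall>n. (\<mu>s n, \<beta>s n) \<in> tangent_pairs \<epsilon> c fun_of) \<longrightarrow>
            (\<mu>, \<beta>) \<in> tangent_pairs \<epsilon> c fun_of \<longrightarrow>
            weak_star_converges \<mu>s \<mu> \<longrightarrow> weakly_converges \<beta>s \<beta> \<longrightarrow>
            ereal (metric_tensor \<epsilon> c fun_of \<mu> \<beta>)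
              \<le> liminf (\<lambda>n. ereal (metric_tensor \<epsilon> c fun_of (\<mu>s n) (\<beta>s n))))"
proof -
  have "compact (UNIV :: ('a \<times> 'a) set)" using compact_Times[OF assms(1) assms(1)] by simp
  then obtain C where "\<And>p. \<bar>(\<lambda>(x, y). c x y) p\<bar> \<le> C"
    using bounded_continuous_compact[OF _ assms(3)] by blast
  from this[of "(_, _)"] have C: "c x y \<le> C" for x y by (simp add: abs_le_iff)
  \<comment> \<open>Here \<open>C\<close> bounds the cost from above, which fixes the lower kernel
    bound \<open>m\<close>; the upper bound 1 comes from nonnegativity of the cost.\<close>
  interpret entropic_rkhs \<epsilon> c fun_of "exp (- C / \<epsilon>)"
  proof
    have "continuous_on UNIV (\<lambda>p. exp (- ((\<lambda>(x, y). c x y) p) / \<epsilon>))"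
      using assms(2,3) by (intro continuous_intros) auto
    then show "continuous_on UNIV (\<lambda>(x, y). kernel_c \<epsilon> c x y)"
      by (simp add: kernel_c_def case_prod_unfold)
    show "exp (- C / \<epsilon>) \<le> kernel_c \<epsilon> c x y" for x y
      using C assms(2) by (simp add: kernel_c_def divide_right_mono)
    show "kernel_c \<epsilon> c x y \<le> 1" for x y
      using assms(2,4) by (simp add: kernel_c_def)
    show "kernel_c \<epsilon> c x y = kernel_c \<epsilon> c y x" for x y
      by (simp add: kernel_c_def assms(5)[of x y])
  qed (use assms in auto)
  show ?thesis using metric_tensor_continuous metric_tensor_lsc by blast
qed

end
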